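(* Let $\vec c$ be a composition of $n$. Then the order complex $\Delta(\Pi^{\bullet}_{\vec c}-\{\hat 1\})$ is homotopy equivalent to the barycentric subdivision $\operatorname{sd}(\Delta_{\vec c})$, and hence to $\Delta_{\vec c}$.
   Context: A pointed set partition of $[n]$ is $\{B_1,\dots,B_k,\underline Z\}$ where $Z\subseteq[n]$ (possibly empty, the pointed block) and $B_1,\dots,B_k$ are nonempty blocks partitioning $[n]\setminus Z$. $\Pi^\bullet_n$ is the poset of these with $\pi\le\pi'$ iff each non-pointed block of $\pi$ lies in some block of $\pi'$ and the pointed block of $\pi$ lies in the pointed block of $\pi'$. Its type is the multiset $\{|B_1|,\dots,|B_k|\}$ together with the pointed number $|Z|$. A pointed composition of $n$ is $(c_1,\dots,c_k)$ with $c_1,\dots,c_{k-1}\ge1$, $c_k\ge0$, sum $n$; a composition if $c_k>0$; ordered by $\vec c\le\vec d$ iff $\vec d$ is obtained from $\vec c$ by replacing runs of consecutive entries by their sums; its type is the multiset $\{c_1,\dots,c_{k-1}\}$ with pointed number $c_k$. $\Pi^\bullet_{\vec c}$ is the induced subposet of $\Pi^\bullet_n$ of all $\pi$ with $\operatorname{type}(\pi)=\operatorname{type}(\vec d)$ for some $\vec d\ge\vec c$; its maximum $\hat 1$ is $\{\underline{[n]}\}$. The order complex $\Delta(P)$ has the chains of $P$ as faces. An ordered set partition of $[n]$ is $(C_1,\dots,C_r)$, pairwise disjoint with union $[n]$, $C_1,\dots,C_{r-1}$ nonempty, $C_r$ possibly empty; type $(|C_1|,\dots,|C_r|)$. $\Delta_n$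 is the simplicial complex with these faces ($(C_1,\dots,C_r)$ of dimension $r-2$, faces obtained by merging consecutive blocks, $([n])$ the empty face; equivalently the order complex of the nonempty subsets of $[n]$), and $\Delta_{\vec c}=\{\tau\in\Delta_n:\vec c\le\operatorname{type}(\tau)\}$. *)

theory Defs
  imports "HOL-Analysis.Analysis" "HOL-Library.Disjoint_Sets" "HOL-Library.Multiset"
begin

section \<open>Simplicial complexes\<close>

text \<open>
  An abstract simplicial complex is represented by its set of faces, each face being a finite
  set of vertices.  The empty face is included.
\<close>

definition order_complex :: "'a set \<Rightarrow> ('a \<Rightarrow> 'a \<Rightarrow> bool) \<Rightarrow> 'a set set" where
  "order_complex P le = {F. finite F \<and> F \<subseteq> P \<and> Complete_Partial_Order.chain le F}"

text \<open>The barycentric subdivision is the order complex of the poset of nonempty faces.\<close>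

definition barycentric_subdivision :: "'a set set \<Rightarrow> 'a set set set" where
  "barycentric_subdivision K = order_complex (K - {{}}) (\<subseteq>)"

text \<open>
  Points of the geometric realization are given by barycentric coordinates, with the topology of
  pointwise convergence, as for \<open>standard_simplex\<close> in the singular homology library.  This is
  the usual topology for finite complexes, the only ones considered here; an infinite complex
  would call for the coherent topology instead.
\<close>

definition geometric_realization :: "'a set set \<Rightarrow> ('a \<Rightarrow> real) topology" where
  "geometric_realization K =
     subtopology (powertop_real UNIV)
       {x. (\<forall>v. 0 \<le> x v) \<and> {v. x v \<noteq> 0} \<in> K \<and> (\<Sum>v | x v \<noteq> 0. x v) = 1}"

section \<open>Pointed set partitions\<close>

text \<open>
  The pair \<open>(B, Z)\<close> stands for the pointed set partition with set of non-pointed blocks \<open>B\<close>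
  and pointed block \<open>Z\<close>.
\<close>

type_synonym pointed_partition = "nat set set \<times> nat set"

definition pointed_partitions :: "nat \<Rightarrow> pointed_partition set" where
  "pointed_partitions n = {(B, Z). Z \<subseteq> {1..n} \<and> partition_on ({1..n} - Z) B}"

definition pp_le :: "pointed_partition \<Rightarrow> pointed_partition \<Rightarrow> bool" where
  "pp_le p q \<longleftrightarrow>
     (\<forall>b\<in>fst p. \<exists>b'\<in>insert (snd q) (fst q). b \<subseteq> b') \<and> snd p \<subseteq> snd q"

definition pp_type :: "pointed_partition \<Rightarrow> nat multiset \<times> nat" where
  "pp_type p = (image_mset card (mset_set (fst p)), card (snd p))"

definition pp_top :: "nat \<Rightarrow> pointed_partition" where
  "pp_top n = ({}, {1..n})"

section \<open>Pointed compositions\<close>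

definition pointed_composition :: "nat \<Rightarrow> nat list \<Rightarrow> bool" where
  "pointed_composition n c \<longleftrightarrow> c \<noteq> [] \<and> (\<forall>x\<in>set (butlast c). 1 \<le> x) \<and> sum_list c = n"

definition composition :: "nat \<Rightarrow> nat list \<Rightarrow> bool" where
  "composition n c \<longleftrightarrow> pointed_composition n c \<and> 0 < last c"

text \<open>The lists in \<open>css\<close> are the runs of consecutive entries that are summed up.\<close>

definition comp_le :: "nat list \<Rightarrow> nat list \<Rightarrow> bool" where
  "comp_le c d \<longleftrightarrow> (\<exists>css. [] \<notin> set css \<and> concat css = c \<and> map sum_list css = d)"

definition comp_type :: "nat list \<Rightarrow> nat multiset \<times> nat" where
  "comp_type c = (mset (butlast c), last c)"

definition pp_poset :: "nat \<Rightarrow> nat list \<Rightarrow> pointed_partition set" where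
  "pp_poset n c =
     {p \<in> pointed_partitions n.
        \<exists>d. pointed_composition n d \<and> comp_le c d \<and> pp_type p = comp_type d}"

section \<open>Ordered set partitions\<close>

definition ordered_partitions :: "nat \<Rightarrow> nat set list set" where
  "ordered_partitions n =
     {Cs. Cs \<noteq> [] \<and> {} \<notin> set (butlast Cs) \<and> sorted_wrt disjnt Cs \<and> \<Union>(set Cs) = {1..n}}"

definition op_type :: "nat set list \<Rightarrow> nat list" where
  "op_type Cs = map card Cs"

text \<open>
  As a face, an ordered set partition of length \<open>r\<close> is the chain of its \<open>r - 1\<close> initial unions
  \<open>C\<^sub>1 \<union> \<dots> \<union> C\<^sub>i\<close> with \<open>1 \<le> i < r\<close>.  Merging the blocks \<open>i\<close> and \<open>i + 1\<close> removes
  the \<open>i\<close>-th vertex of this chain.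
\<close>

definition op_face :: "nat set list \<Rightarrow> nat set set" where
  "op_face Cs = {\<Union>(set (take i Cs)) |i. 1 \<le> i \<and> i < length Cs}"

definition op_complex :: "nat \<Rightarrow> nat list \<Rightarrow> nat set set set" where
  "op_complex n c = op_face ` {Cs \<in> ordered_partitions n. comp_le c (op_type Cs)}"

section \<open>Basic properties\<close>

lemma pp_le_refl: "pp_le p p"
  by (auto simp: pp_le_def)

lemma pp_le_trans: "pp_le p q \<Longrightarrow> pp_le q r \<Longrightarrow> pp_le p r"
  unfolding pp_le_def by (smt (verit) insert_iff order_trans)

lemma pp_le_antisym_blocks:
  assumes p: "(B, Z) \<in> pointed_partitions n" and q: "(B', Z) \<in> pointed_partitions n"
    and pq: "pp_le (B, Z) (B', Z)" and qp: "pp_le (B', Z) (B, Z)"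
  shows "B \<subseteq> B'"
proof
  fix b assume b: "b \<in> B"
  have part: "partition_on ({1..n} - Z) B" "partition_on ({1..n} - Z) B'"
    using p q by (auto simp: pointed_partitions_def)
  have ne: "b \<noteq> {}" and bZ: "b \<inter> Z = {}"
    using part(1) b by (auto simp: partition_on_def)
  have "\<not> b \<subseteq> Z"
    using ne bZ by blast
  then obtain b' where b': "b' \<in> B'" "b \<subseteq> b'"
    using pq b by (auto simp: pp_le_def)
  have "\<not> b' \<subseteq> Z"
    using b'(2) ne bZ by blast
  then obtain b'' where b'': "b'' \<in> B" "b' \<subseteq> b''"
    using qp b'(1) by (auto simp: pp_le_def)
  have "b = b''"
    using disjointD[OF partition_onD2[OF part(1)] b b''(1)] ne b'(2) b''(2) by blast
  then show "b \<in> B'"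
    using b' b'' by auto
qed

lemma pp_le_antisym:
  assumes "p \<in> pointed_partitions n" "q \<in> pointed_partitions n" "pp_le p q" "pp_le q p"
  shows "p = q"
proof -
  obtain B Z B' Z' where [simp]: "p = (B, Z)" "q = (B', Z')"
    by (cases p, cases q)
  have [simp]: "Z' = Z"
    using assms(3,4) by (auto simp: pp_le_def)
  show ?thesis
    using assms pp_le_antisym_blocks[of B Z n B'] pp_le_antisym_blocks[of B' Z n B] by auto
qed

lemma pp_le_top: "p \<in> pointed_partitions n \<Longrightarrow> pp_le p (pp_top n)"
  by (auto simp: pointed_partitions_def pp_le_def pp_top_def partition_on_def)

lemma pp_top_in_pp_poset:
  assumes "pointed_composition n c"
  shows "pp_top n \<in> pp_poset n c"
proof -
  have "comp_le c [n]"
    unfolding comp_le_def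
    by (rule exI[of _ "[c]"]) (use assms in \<open>auto simp: pointed_composition_def\<close>)
  then show ?thesis
    by (auto simp: pp_poset_def pp_top_def pointed_partitions_def pp_type_def comp_type_def
        pointed_composition_def partition_on_def intro!: exI[of _ "[n]"])
qed

end

theory Submission
  imports Defs
begin

text \<open>
  Since \<open>c\<close> is a composition, \<open>\<Delta>\<^bsub>c\<^esub>\<close> is the order complex of the set of
  those \<open>S \<subseteq> [n]\<close> whose size is a proper nonempty partial sum of \<open>c\<close>.  Forgetting
  the order of the blocks gives an order-reversing map \<open>f\<close> from its nonempty faces to
  \<open>\<Pi>\<^bsub>c\<^esub> - {1}\<close>, and \<open>g (B, Z) = [n] - Z\<close> is an order-reversing map back to
  its vertices.  Instead of Quillen's fiber lemma one can use that \<open>g (f C)\<close> is the largest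
  vertex of the chain \<open>C\<close>, so that \<open>g \<circ> f\<close> is the last vertex map of the subdivision, and
  that \<open>f (g ` F)\<close> lies above the minimum of \<open>F\<close> for every nonempty chain \<open>F\<close> of pointed
  partitions, so that \<open>f \<circ> sd g\<close> is homotopic to the first vertex map.  As these vertex maps
  are homotopy equivalences, \<open>f\<close> has a left and a right homotopy inverse.
\<close>

section \<open>Maps and homotopies between geometric realizations\<close>

abbreviation supp :: "('a \<Rightarrow> real) \<Rightarrow> 'a set" where
  "supp x \<equiv> {v. x v \<noteq> 0}"

text \<open>Finiteness is asked of the vertex set because coordinates are summed over
  \<open>\<Union>K\<close>; finitely many faces follow.\<close>

definition finite_complex :: "'a set set \<Rightarrow> bool" where
  "finite_complex K \<longleftrightarrow> finite (\<Union>K) \<and> (\<forall>F\<in>K. \<forall>G\<subseteq>F. G \<in> K)"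

lemma finite_complex_subset: "finite_complex K \<Longrightarrow> F \<in> K \<Longrightarrow> G \<subseteq> F \<Longrightarrow> G \<in> K"
  by (auto simp: finite_complex_def)

lemma finite_complex_finite: "finite_complex K \<Longrightarrow> F \<in> K \<Longrightarrow> finite F"
  by (meson Union_upper finite_complex_def finite_subset)

lemma finite_complex_order_complex: "finite A \<Longrightarrow> finite_complex (order_complex A le)"
proof -
  assume A: "finite A"
  have "\<Union>(order_complex A le) \<subseteq> A"
    by (auto simp: order_complex_def)
  moreover have "G \<in> order_complex A le" if "F \<in> order_complex A le" "G \<subseteq> F" for F G
    using that by (auto simp: order_complex_def Complete_Partial_Order.chain_def
        intro: finite_subset)
  ultimately show ?thesis
    using A by (auto simp: finite_complex_def intro: finite_subset)
qed

lemma finite_complex_barycentric_subdivision: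
  assumes "finite_complex K" shows "finite_complex (barycentric_subdivision K)"
proof -
  have "K \<subseteq> Pow (\<Union>K)" by auto
  then have "finite K"
    using assms by (meson finite_Pow_iff finite_complex_def finite_subset)
  then show ?thesis
    by (simp add: barycentric_subdivision_def finite_complex_order_complex)
qed

section \<open>Points of a realization and continuity in coordinates\<close>

lemma topspace_geometric_realization:
  "topspace (geometric_realization K) =
     {x. (\<forall>v. 0 \<le> x v) \<and> supp x \<in> K \<and> sum x (supp x) = 1}"
  by (simp add: geometric_realization_def)

lemma continuous_map_geometric_realization:
  "continuous_map X (geometric_realization K) h \<longleftrightarrow>
     (\<forall>v. continuous_map X euclideanreal (\<lambda>x. h x v)) \<and>
     h \<in> topspace X \<rightarrow> topspace (geometric_realization K)"
  by (simp add: geometric_realization_def continuous_map_in_subtopology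
      continuous_map_componentwise_UNIV)

lemma continuous_map_coordinate:
  "continuous_map X (geometric_realization K) h \<Longrightarrow> continuous_map X euclideanreal (\<lambda>x. h x v)"
  by (simp add: continuous_map_geometric_realization)

lemma continuous_map_if_const:
  "continuous_map X euclideanreal f \<Longrightarrow> continuous_map X euclideanreal (\<lambda>x. if P then f x else 0)"
  by (cases P) auto

lemma geometric_realization_nonneg:
  "x \<in> topspace (geometric_realization K) \<Longrightarrow> 0 \<le> x v"
  by (simp add: topspace_geometric_realization)

lemma geometric_realization_supp:
  "x \<in> topspace (geometric_realization K) \<Longrightarrow> supp x \<in> K"
  by (simp add: topspace_geometric_realization)

text \<open>The support varies with the point; a fixed finite index set lets the coordinate sum be
  treated uniformly over the space.\<close>

lemma geometric_realization_sum:
  assumes "x \<in> topspace (geometric_realization K)" "finite V" "\<Union>K \<subseteq> V"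
  shows "sum x V = 1"
proof -
  have "sum x (supp x) = sum x V"
    by (rule sum.mono_neutral_left) (use assms geometric_realization_supp[OF assms(1)] in auto)
  then show ?thesis
    using assms(1) by (simp add: topspace_geometric_realization)
qed

lemma geometric_realization_supp_nonempty:
  "x \<in> topspace (geometric_realization K) \<Longrightarrow> supp x \<noteq> {}"
  by (intro notI) (simp only: topspace_geometric_realization mem_Collect_eq sum.empty, simp)

lemma geometric_realizationI:
  assumes "\<And>v. 0 \<le> x v" "supp x \<in> K" "finite V" "supp x \<subseteq> V" "sum x V = 1"
  shows "x \<in> topspace (geometric_realization K)"
proof -
  have "sum x (supp x) = sum x V"
    by (rule sum.mono_neutral_left) (use assms in auto)
  then show ?thesis
    using assms by (simp add: topspace_geometric_realization)
qed

text \<open>A convex combination of two points is supported in the union of their supports. As that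
  union is a face, downward closure keeps every intermediate point in the realization.\<close>

lemma homotopic_straight_line:
  assumes K: "finite_complex K"
    and f: "continuous_map X (geometric_realization K) f"
    and g: "continuous_map X (geometric_realization K) g"
    and fg: "\<And>x. x \<in> topspace X \<Longrightarrow> supp (f x) \<union> supp (g x) \<in> K"
  shows "homotopic_with (\<lambda>_. True) X (geometric_realization K) f g"
proof -
  define h where "h = (\<lambda>p v. (1 - fst p) * f (snd p) v + fst p * g (snd p) v)"
  let ?T = "prod_topology (top_of_set {0..1::real}) X"
  have fX: "f x \<in> topspace (geometric_realization K)" if "x \<in> topspace X" for x
    using f that by (auto simp: continuous_map_geometric_realization)
  have gX: "g x \<in> topspace (geometric_realization K)" if "x \<in> topspace X" for x
    using g that by (auto simp: continuous_map_geometric_realization)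
  have t: "continuous_map ?T euclideanreal fst"
    using continuous_map_fst continuous_map_into_fulltopology by blast
  have "continuous_map ?T (geometric_realization K) (f \<circ> snd)"
    "continuous_map ?T (geometric_realization K) (g \<circ> snd)"
    using f g continuous_map_snd continuous_map_compose by blast+
  from this[THEN continuous_map_coordinate]
  have "continuous_map ?T euclideanreal (\<lambda>p. h p v)" for v
    unfolding h_def o_def using t by (intro continuous_intros) auto
  moreover have "h p \<in> topspace (geometric_realization K)" if p: "p \<in> topspace ?T" for p
  proof -
    obtain s x where [simp]: "p = (s, x)" and s: "0 \<le> s" "s \<le> 1" and x: "x \<in> topspace X"
      using p by auto
    have nn: "0 \<le> f x v" "0 \<le> g x v" for v
      using fX[OF x] gX[OF x] geometric_realization_nonneg by metis+
    have sub: "supp (h p) \<subseteq> supp (f x) \<union> supp (g x)"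
      by (auto simp: h_def)
    have fin: "finite (\<Union>K)"
      using K by (simp add: finite_complex_def)
    show ?thesis
    proof (rule geometric_realizationI)
      show "0 \<le> h p v" for v
        using nn s by (simp add: h_def)
      show "supp (h p) \<in> K"
        using sub fg[OF x] K finite_complex_subset by blast
      show "supp (h p) \<subseteq> \<Union>K"
        using sub fg[OF x] by blast
      show "sum (h p) (\<Union>K) = 1"
        using geometric_realization_sum[OF fX[OF x] fin] geometric_realization_sum[OF gX[OF x] fin]
        by (simp add: h_def sum.distrib flip: sum_distrib_left)
    qed (use fin in auto)
  qed
  ultimately have "continuous_map ?T (geometric_realization K) h"
    by (auto simp: continuous_map_geometric_realization)
  then show ?thesis
    by (subst homotopic_with) (auto simp: h_def intro!: exI[of _ h])
qed

section \<open>Simplicial maps induced by vertex maps\<close>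

text \<open>\<open>V\<close> only serves to make the sum finite; it must contain the support of \<open>x\<close>.\<close>

definition pushforward :: "'a set \<Rightarrow> ('a \<Rightarrow> 'b) \<Rightarrow> ('a \<Rightarrow> real) \<Rightarrow> 'b \<Rightarrow> real" where
  "pushforward V \<phi> x w = (\<Sum>v\<in>V. if \<phi> v = w then x v else 0)"

lemma pushforward_nonneg: "(\<And>v. 0 \<le> x v) \<Longrightarrow> 0 \<le> pushforward V \<phi> x w"
  by (simp add: pushforward_def sum_nonneg)

text \<open>With nonnegative coordinates, masses sent to the same vertex cannot cancel.\<close>

lemma supp_pushforward:
  assumes "finite V" "supp x \<subseteq> V" "\<And>v. 0 \<le> x v"
  shows "supp (pushforward V \<phi> x) = \<phi> ` supp x"
proof -
  have "pushforward V \<phi> x w = 0 \<longleftrightarrow> (\<forall>v\<in>V. \<phi> v = w \<longrightarrow> x v = 0)" for w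
    unfolding pushforward_def by (subst sum_nonneg_eq_0_iff) (use assms in auto)
  then show ?thesis
    using assms(2) by auto
qed

lemma sum_pushforward:
  assumes "finite V" "finite W" "\<phi> ` V \<subseteq> W"
  shows "sum (pushforward V \<phi> x) W = sum x V"
proof -
  have "sum (pushforward V \<phi> x) W = (\<Sum>v\<in>V. \<Sum>w\<in>W. if \<phi> v = w then x v else 0)"
    unfolding pushforward_def by (rule sum.swap)
  also have "\<dots> = sum x V"
    using assms by (intro sum.cong) (auto simp: sum.delta)
  finally show ?thesis .
qed

lemma supp_pushforward_realization:
  assumes "finite_complex K" "x \<in> topspace (geometric_realization K)"
  shows "supp (pushforward (\<Union>K) \<phi> x) = \<phi> ` supp x"
  using assms geometric_realization_supp[OF assms(2)]
  by (intro supp_pushforward) (auto simp: finite_complex_def geometric_realization_nonneg)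

text \<open>This is the simplicial map of \<open>\<phi>\<close>: coordinates are transported
  linearly, and the support of a point goes to its image, again a face.\<close>

lemma continuous_map_pushforward:
  assumes K: "finite_complex K" and \<phi>: "\<And>F. F \<in> K \<Longrightarrow> \<phi> ` F \<in> L"
  shows "continuous_map (geometric_realization K) (geometric_realization L) (pushforward (\<Union>K) \<phi>)"
  unfolding continuous_map_geometric_realization
proof (intro conjI allI funcsetI)
  have fin: "finite (\<Union>K)"
    using K by (simp add: finite_complex_def)
  show "continuous_map (geometric_realization K) euclideanreal (\<lambda>x. pushforward (\<Union>K) \<phi> x w)" for w
    unfolding pushforward_def
    by (intro continuous_map_sum fin)
      (auto intro: continuous_map_coordinate[OF continuous_map_id, unfolded id_def])
  fix x assume x: "x \<in> topspace (geometric_realization K)"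
  note supp = supp_pushforward_realization[OF K x, of \<phi>]
  show "pushforward (\<Union>K) \<phi> x \<in> topspace (geometric_realization L)"
  proof (rule geometric_realizationI)
    show "supp (pushforward (\<Union>K) \<phi> x) \<in> L"
      using supp \<phi> geometric_realization_supp[OF x] by simp
    show "supp (pushforward (\<Union>K) \<phi> x) \<subseteq> \<phi> ` \<Union>K"
      using supp geometric_realization_supp[OF x] by auto
    show "sum (pushforward (\<Union>K) \<phi> x) (\<phi> ` \<Union>K) = 1"
      using fin geometric_realization_sum[OF x fin] by (simp add: sum_pushforward)
  qed (use fin x in \<open>auto simp: pushforward_nonneg geometric_realization_nonneg\<close>)
qed

text \<open>
  The mass of the points of a chain is moved from \<open>a\<close> to \<open>b\<close> one point after the other, from the
  top down, so that at each time at most one point has mass at both places.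
\<close>

lemma homotopic_pushforward_le:
  fixes Q :: "'a set" and P :: "'b set" and le :: "'a \<Rightarrow> 'a \<Rightarrow> bool" and le' :: "'b \<Rightarrow> 'b \<Rightarrow> bool"
  defines "K \<equiv> order_complex Q le" and "L \<equiv> order_complex P le'"
  assumes Q: "finite Q" and P: "finite P"
    and antisym: "\<And>x y. le x y \<Longrightarrow> le y x \<Longrightarrow> x = y"
    and trans: "\<And>x y z. le x y \<Longrightarrow> le y z \<Longrightarrow> le x z"
    and trans': "\<And>x y z. le' x y \<Longrightarrow> le' y z \<Longrightarrow> le' x z"
    and aP: "\<And>x. x \<in> Q \<Longrightarrow> a x \<in> P" and bP: "\<And>x. x \<in> Q \<Longrightarrow> b x \<in> P"
    and a_mono: "\<And>x y. x \<in> Q \<Longrightarrow> y \<in> Q \<Longrightarrow> le x y \<Longrightarrow> le' (a x) (a y)"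
    and b_mono: "\<And>x y. x \<in> Q \<Longrightarrow> y \<in> Q \<Longrightarrow> le x y \<Longrightarrow> le' (b x) (b y)"
    and ab: "\<And>x. x \<in> Q \<Longrightarrow> le' (a x) (b x)"
  shows "homotopic_with (\<lambda>_. True) (geometric_realization K) (geometric_realization L)
           (pushforward (\<Union>K) a) (pushforward (\<Union>K) b)"
proof -
  let ?V = "\<Union>K"
  have K: "finite_complex K"
    unfolding K_def by (rule finite_complex_order_complex[OF Q])
  then have fin: "finite ?V"
    by (simp add: finite_complex_def)
  have VQ: "?V \<subseteq> Q"
    by (auto simp: K_def order_complex_def)
  \<comment> \<open>At time \<open>s\<close> the topmost \<open>s\<close> units of mass have been
    moved. The part taken from \<open>q\<close> is the excess of \<open>s\<close> over the mass
    strictly above \<open>q\<close>, clamped between 0 and the mass of \<open>q\<close>.\<close>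
  define above where "above = (\<lambda>x q. \<Sum>q'\<in>?V. if le q q' \<and> q \<noteq> q' then x q' else (0::real))"
  define moved where "moved = (\<lambda>p q. min (snd p q) (max 0 (fst p - above (snd p) q)))"
  define h where "h = (\<lambda>p w. pushforward ?V a (\<lambda>q. snd p q - moved p q) w
      + pushforward ?V b (moved p) w)"
  let ?T = "prod_topology (top_of_set {0..1::real}) (geometric_realization K)"
  have t: "continuous_map ?T euclideanreal fst"
    using continuous_map_fst continuous_map_into_fulltopology by blast
  have x: "continuous_map ?T euclideanreal (\<lambda>p. snd p q)" for q
    using continuous_map_coordinate[OF continuous_map_snd] .
  have m: "continuous_map ?T euclideanreal (\<lambda>p. moved p q)" for q
    unfolding moved_def above_def
    by (intro continuous_map_real_min continuous_map_real_max continuous_map_diff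
        continuous_map_sum continuous_map_if_const t x fin) auto
  have "continuous_map ?T euclideanreal (\<lambda>p. h p w)" for w
    unfolding h_def pushforward_def
    by (intro continuous_map_add continuous_map_diff continuous_map_sum
        continuous_map_if_const x m fin)
  moreover have "h p \<in> topspace (geometric_realization L)" if p: "p \<in> topspace ?T" for p
  proof -
    obtain s x where [simp]: "p = (s, x)" and s: "0 \<le> s" "s \<le> 1"
      and x: "x \<in> topspace (geometric_realization K)"
      using p by auto
    have nn: "0 \<le> x v" for v
      using geometric_realization_nonneg[OF x] .
    have sx: "supp x \<subseteq> ?V"
      using geometric_realization_supp[OF x] by blast
    have chain: "le v w \<or> le w v" if "v \<in> supp x" "w \<in> supp x" for v w
      using geometric_realization_supp[OF x] that
      by (auto simp: K_def order_complex_def Complete_Partial_Order.chain_def)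
    let ?m = "moved p"
    have m0: "0 \<le> ?m q" "?m q \<le> x q" for q
      using nn[of q] by (auto simp: moved_def)
    have sa: "supp (\<lambda>q. x q - ?m q) \<subseteq> supp x"
    proof clarify
      fix q assume "x q - ?m q \<noteq> 0" "x q = 0"
      then show False using m0[of q] by linarith
    qed
    have sb: "supp ?m \<subseteq> supp x"
    proof clarify
      fix q assume "?m q \<noteq> 0" "x q = 0"
      then show False using m0[of q] by linarith
    qed
    \<comment> \<open>Otherwise \<open>q\<close> lies strictly below \<open>q'\<close>, so all mass
      at or above \<open>q'\<close> counts as above \<open>q\<close>. But \<open>q\<close> starts to
      move only when \<open>above x q < s\<close>, while \<open>q'\<close> still retains mass only
      if \<open>s < above x q' + x q'\<close>.\<close>
    have key: "le q' q" if q: "?m q \<noteq> 0" and q': "x q' \<noteq> ?m q'" for q q'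
    proof (rule ccontr)
      assume n: "\<not> le q' q"
      have ss: "q \<in> supp x" "q' \<in> supp x"
        using q q' sa sb by auto
      with n chain have le: "le q q'" "q \<noteq> q'"
        by blast+
      have "q' \<in> ?V" using ss sx by auto
      have "above x q' + x q' = (\<Sum>v\<in>?V. (if le q' v \<and> q' \<noteq> v then x v else 0) + (if v = q' then x v else 0))"
        unfolding above_def sum.distrib using fin \<open>q' \<in> ?V\<close> by simp
      also have "\<dots> = (\<Sum>v\<in>?V. if (le q' v \<and> q' \<noteq> v) \<or> v = q' then x v else 0)"
        by (rule sum.cong) auto
      also have "\<dots> \<le> above x q"
        unfolding above_def
      proof (rule sum_mono)
        fix v assume "v \<in> ?V"
        have "le q v \<and> q \<noteq> v" if v: "le q' v" "x v \<noteq> 0"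
        proof -
          have "le q v"
            using trans le(1) v(1) by blast
          then show ?thesis using v le antisym by blast
        qed
        then show "(if (le q' v \<and> q' \<noteq> v) \<or> v = q' then x v else 0) \<le> (if le q v \<and> q \<noteq> v then x v else 0)"
          using nn[of v] le by auto
      qed
      finally have "above x q' + x q' \<le> above x q" .
      moreover have "above x q < s" "s < above x q' + x q'"
        using q q' nn[of q] nn[of q'] by (auto simp: moved_def min_def max_def split: if_splits)
      ultimately show False by simp
    qed
    have supph: "supp (h p) \<subseteq> a ` supp (\<lambda>q. x q - ?m q) \<union> b ` supp ?m" (is "_ \<subseteq> ?S")
    proof -
      have "supp (pushforward ?V a (\<lambda>q. x q - ?m q)) = a ` supp (\<lambda>q. x q - ?m q)"
        by (rule supp_pushforward) (use fin sa sx m0 in auto)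
      moreover have "supp (pushforward ?V b ?m) = b ` supp ?m"
        by (rule supp_pushforward) (use fin sb sx m0 in auto)
      ultimately show ?thesis
        by (fastforce simp: h_def)
    qed
    have finS: "finite ?S"
      using sa sb sx fin by (meson finite_UnI finite_imageI finite_subset)
    have inQ: "supp (\<lambda>q. x q - ?m q) \<subseteq> Q" "supp ?m \<subseteq> Q"
      using sa sb sx VQ by blast+
    have "Complete_Partial_Order.chain le' ?S"
    proof (rule chainI)
      fix u w assume u: "u \<in> ?S" and w: "w \<in> ?S"
      \<comment> \<open>An old place and a new place are compared through \<open>a q\<close>:
        \<open>key\<close> gives \<open>le q' q\<close>, so \<open>a q'\<close> is below
        \<open>a q\<close>, which is below \<open>b q\<close>.\<close>
      have A: "le' (a q') (b q)" if "q' \<in> supp (\<lambda>q. x q - ?m q)" "q \<in> supp ?m" for q q'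
      proof -
        have "le q' q" using key that by auto
        then show ?thesis
          using that inQ a_mono ab trans' by blast
      qed
      have B: "le' (a q') (a q) \<or> le' (a q) (a q')"
        if "q' \<in> supp (\<lambda>q. x q - ?m q)" "q \<in> supp (\<lambda>q. x q - ?m q)" for q q'
        using chain[of q q'] that sa inQ a_mono by blast
      have C: "le' (b q') (b q) \<or> le' (b q) (b q')"
        if "q' \<in> supp ?m" "q \<in> supp ?m" for q q'
        using chain[of q q'] that sb inQ b_mono by blast
      show "le' u w \<or> le' w u"
        using u w A B C by blast
    qed
    then have SL: "?S \<in> L"
      using finS inQ aP bP by (auto simp: L_def order_complex_def)
    show ?thesis
    proof (rule geometric_realizationI)
      show "0 \<le> h p v" for v
        using m0 by (simp add: h_def pushforward_nonneg)
      show "supp (h p) \<in> L"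
        using SL supph finite_complex_order_complex[OF P] finite_complex_subset unfolding L_def by blast
      show "supp (h p) \<subseteq> a ` ?V \<union> b ` ?V"
        using supph sa sb sx by (meson Un_mono image_mono order_trans)
      have "sum (h p) (a ` ?V \<union> b ` ?V) = sum (\<lambda>q. x q - ?m q) ?V + sum ?m ?V"
        unfolding h_def sum.distrib using fin by (simp add: sum_pushforward)
      also have "\<dots> = 1"
        using geometric_realization_sum[OF x fin] by (simp flip: sum.distrib)
      finally show "sum (h p) (a ` ?V \<union> b ` ?V) = 1" .
    qed (use fin in auto)
  qed
  ultimately have cont: "continuous_map ?T (geometric_realization L) h"
    by (auto simp: continuous_map_geometric_realization)
  have h0: "h (0, x) = pushforward ?V a x" if x: "x \<in> topspace (geometric_realization K)" for x
  proof -
    have "0 \<le> above x q" for q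
      unfolding above_def by (intro sum_nonneg) (auto simp: geometric_realization_nonneg[OF x])
    then have "moved (0, x) q = 0" for q
      using geometric_realization_nonneg[OF x, of q] by (simp add: moved_def)
    then show ?thesis
      by (simp add: h_def pushforward_def fun_eq_iff cong: if_cong)
  qed
  have h1: "h (1, x) = pushforward ?V b x" if x: "x \<in> topspace (geometric_realization K)" for x
  proof -
    \<comment> \<open>At time 1 everything has moved, since the mass of \<open>q\<close> and the
      mass above it add up to at most the total mass 1.\<close>
    have le1: "x q \<le> 1 - above x q" if "q \<in> ?V" for q
    proof -
      have "above x q + x q = (\<Sum>v\<in>?V. (if le q v \<and> q \<noteq> v then x v else 0) + (if v = q then x v else 0))"
        unfolding above_def sum.distrib using fin that by simp
      also have "\<dots> \<le> sum x ?V"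
        by (rule sum_mono) (auto simp: geometric_realization_nonneg[OF x])
      finally show ?thesis
        using geometric_realization_sum[OF x fin] by simp
    qed
    have all: "moved (1, x) q = x q" if "q \<in> ?V" for q
      using le1[OF that] geometric_realization_nonneg[OF x, of q] by (simp add: moved_def)
    have "pushforward ?V a (\<lambda>q. x q - moved (1, x) q) w = 0" for w
      unfolding pushforward_def using all by (intro sum.neutral) fastforce
    moreover have "pushforward ?V b (moved (1, x)) w = pushforward ?V b x w" for w
      unfolding pushforward_def using all by (intro sum.cong refl) presburger
    ultimately show ?thesis
      by (simp add: h_def fun_eq_iff)
  qed
  show ?thesis
  proof (subst homotopic_with)
    show "\<exists>h. continuous_map ?T (geometric_realization L) h \<and>
      (\<forall>x\<in>topspace (geometric_realization K). h (0, x) = pushforward ?V a x) \<and>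
      (\<forall>x\<in>topspace (geometric_realization K). h (1, x) = pushforward ?V b x) \<and>
      (\<forall>t\<in>{0..1::real}. True)"
      using cont h0 h1 by (intro exI[of _ h] conjI ballI TrueI)
  qed simp
qed

section \<open>Extremal members of finite chains\<close>

lemma chain_subset_Union_mem:
  assumes "finite C" "C \<noteq> {}" "Complete_Partial_Order.chain (\<subseteq>) C"
  shows "\<Union>C \<in> C"
  using assms
proof (induction C rule: finite_ne_induct)
  case (insert S C)
  have "\<Union>C \<in> C"
    using insert by (meson chain_subset subset_insertI)
  moreover from this have "\<Union>C \<subseteq> S \<or> S \<subseteq> \<Union>C"
    using insert.prems by (auto simp: Complete_Partial_Order.chain_def)
  ultimately show ?case
    by (auto simp: Un_absorb1 Un_absorb2)
qed simp

text \<open>Reflexivity on the members comes from \<open>chain\<close>, which compares every member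
  also with itself.\<close>

lemma chain_least:
  assumes "finite C" "C \<noteq> {}" "Complete_Partial_Order.chain le C"
    and "\<And>x y z. le x y \<Longrightarrow> le y z \<Longrightarrow> le x z"
  shows "\<exists>x\<in>C. \<forall>y\<in>C. le x y"
  using assms(1-3)
proof (induction C rule: finite_ne_induct)
  case (singleton x)
  then show ?case by (auto simp: Complete_Partial_Order.chain_def)
next
  case (insert x C)
  have "Complete_Partial_Order.chain le C"
    using insert.prems by (meson chain_subset subset_insertI)
  then obtain m where m: "m \<in> C" "\<forall>y\<in>C. le m y"
    using insert.IH by blast
  have "le x x" "le x m \<or> le m x"
    using insert.prems m(1) by (auto simp: Complete_Partial_Order.chain_def)
  then show ?case
    using m assms(4) by (metis insert_iff)
qed

lemma barycentric_subdivision_iff: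
  "C \<in> barycentric_subdivision K \<longleftrightarrow>
     finite C \<and> C \<subseteq> K - {{}} \<and> Complete_Partial_Order.chain (\<subseteq>) C"
  by (simp add: barycentric_subdivision_def order_complex_def)

lemma Union_barycentric_subdivision: "\<Union>(barycentric_subdivision K) = K - {{}}"
proof
  show "K - {{}} \<subseteq> \<Union>(barycentric_subdivision K)"
  proof
    fix F assume "F \<in> K - {{}}"
    then have "{F} \<in> barycentric_subdivision K"
      by (auto simp: barycentric_subdivision_iff Complete_Partial_Order.chain_def)
    then show "F \<in> \<Union>(barycentric_subdivision K)"
      by blast
  qed
qed (auto simp: barycentric_subdivision_iff)

section \<open>The barycentric subdivision\<close>

text \<open>
  The weight of \<open>F\<close> is positive iff \<open>F\<close> is a strict superlevel set of \<open>x\<close>.  Since superlevel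
  sets form a chain, normalizing the weights gives a map to the barycentric subdivision, which is a
  homotopy inverse of the usual homeomorphism.
\<close>

definition level_weight :: "'a set \<Rightarrow> ('a \<Rightarrow> real) \<Rightarrow> 'a set \<Rightarrow> real" where
  "level_weight V x F = (\<Prod>v\<in>F. x v * (\<Prod>w\<in>V - F. max 0 (x v - x w)))"

definition to_subdivision :: "'a set \<Rightarrow> ('a \<Rightarrow> real) \<Rightarrow> 'a set \<Rightarrow> real" where
  "to_subdivision V x F =
     (if F \<in> Pow V - {{}} then level_weight V x F / (\<Sum>G\<in>Pow V - {{}}. level_weight V x G) else 0)"

lemma level_weight_nonneg: "(\<And>v. 0 \<le> x v) \<Longrightarrow> 0 \<le> level_weight V x F"
  by (simp add: level_weight_def prod_nonneg)

lemma level_weight_neq_0_iff: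
  assumes "finite V" "F \<subseteq> V"
  shows "level_weight V x F \<noteq> 0 \<longleftrightarrow> (\<forall>v\<in>F. x v \<noteq> 0 \<and> (\<forall>w\<in>V - F. x w < x v))"
proof -
  have "finite F" "finite (V - F)"
    using assms finite_subset by auto
  moreover have "max 0 (x v - x w) = 0 \<longleftrightarrow> \<not> x w < x v" for v w
    by (auto simp: max_def)
  ultimately show ?thesis
    unfolding level_weight_def by simp
qed

text \<open>The set where \<open>x\<close> attains its maximum over \<open>V\<close> is a strict
  superlevel set, and the maximum is positive, so this set has positive weight. The result makes the
  denominator in \<open>to_subdivision\<close> nonzero.\<close>

lemma sum_level_weight_pos:
  assumes V: "finite V" and x: "\<And>v. 0 \<le> x v" and u: "u \<in> V" "x u \<noteq> 0"
  shows "0 < sum (level_weight V x) (Pow V - {{}})"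
proof -
  define F where "F = {v \<in> V. x v = Max (x ` V)}"
  have le: "x v \<le> Max (x ` V)" if "v \<in> V" for v
    using V that by simp
  have "Max (x ` V) \<in> x ` V"
    using V u by (intro Max_in) auto
  then have F: "F \<in> Pow V - {{}}"
    by (auto simp: F_def)
  have "0 < Max (x ` V)"
    using le[OF u(1)] x[of u] u(2) by linarith
  have "level_weight V x F \<noteq> 0"
  proof (subst level_weight_neq_0_iff)
    show "\<forall>v\<in>F. x v \<noteq> 0 \<and> (\<forall>w\<in>V - F. x w < x v)"
      using le \<open>0 < Max (x ` V)\<close> by (auto simp: F_def less_le)
  qed (use F V in auto)
  moreover have nonneg: "0 \<le> level_weight V x G" for G
    using x by (rule level_weight_nonneg)
  ultimately have "0 < level_weight V x F"
    by (simp add: less_le)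
  with _ F show ?thesis
    by (rule sum_pos2) (use V nonneg in simp_all)
qed

lemma supp_to_subdivision:
  assumes "finite V" "\<And>v. 0 \<le> x v" "u \<in> V" "x u \<noteq> 0"
  shows "supp (to_subdivision V x) =
    {F \<in> Pow V - {{}}. \<forall>v\<in>F. x v \<noteq> 0 \<and> (\<forall>w\<in>V - F. x w < x v)}"
proof -
  have "sum (level_weight V x) (Pow V - {{}}) \<noteq> 0"
    using sum_level_weight_pos[of V x u, OF assms] by (rule less_imp_neq[symmetric])
  then have "to_subdivision V x F \<noteq> 0 \<longleftrightarrow> F \<in> Pow V - {{}} \<and> level_weight V x F \<noteq> 0" for F
    unfolding to_subdivision_def by simp
  also have "\<dots> F \<longleftrightarrow> F \<in> Pow V - {{}} \<and> (\<forall>v\<in>F. x v \<noteq> 0 \<and> (\<forall>w\<in>V - F. x w < x v))" for F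
    using level_weight_neq_0_iff[OF assms(1), of F x] by blast
  finally show ?thesis
    by (rule Collect_cong)
qed

lemma supp_to_subdivision_realization:
  assumes "finite_complex K" "x \<in> topspace (geometric_realization K)"
  shows "supp (to_subdivision (\<Union>K) x) =
    {F \<in> Pow (\<Union>K) - {{}}. \<forall>v\<in>F. x v \<noteq> 0 \<and> (\<forall>w\<in>\<Union>K - F. x w < x v)}"
proof -
  obtain u where "u \<in> \<Union>K" "x u \<noteq> 0"
    using geometric_realization_supp[OF assms(2)] geometric_realization_supp_nonempty[OF assms(2)]
    by blast
  then show ?thesis
    using assms by (intro supp_to_subdivision) (auto simp: finite_complex_def geometric_realization_nonneg)
qed

lemma Union_supp_to_subdivision_subset:
  assumes "finite_complex K" "x \<in> topspace (geometric_realization K)"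
  shows "\<Union>(supp (to_subdivision (\<Union>K) x)) \<subseteq> supp x"
  unfolding supp_to_subdivision_realization[OF assms] by blast

text \<open>The denominator is positive on the whole realization, so the normalized weights are
  continuous. The sets of positive weight are faces, being subsets of the support of
  \<open>x\<close>, and they form a chain.\<close>

lemma continuous_map_to_subdivision:
  assumes K: "finite_complex K"
  shows "continuous_map (geometric_realization K) (geometric_realization (barycentric_subdivision K))
           (to_subdivision (\<Union>K))"
  unfolding continuous_map_geometric_realization
proof (intro conjI allI funcsetI)
  let ?V = "\<Union>K"
  have fin: "finite ?V"
    using K by (simp add: finite_complex_def)
  have pos: "0 < (\<Sum>G\<in>Pow ?V - {{}}. level_weight ?V x G)"
    if x: "x \<in> topspace (geometric_realization K)" for x
  proof -
    obtain u where "u \<in> ?V" "x u \<noteq> 0"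
      using geometric_realization_supp[OF x] geometric_realization_supp_nonempty[OF x] by blast
    then show ?thesis
      using sum_level_weight_pos[OF fin, of x u] geometric_realization_nonneg[OF x] by blast
  qed
  have coord: "continuous_map (geometric_realization K) euclideanreal (\<lambda>x. x v)" for v
    using continuous_map_coordinate[OF continuous_map_id] by simp
  have weight: "continuous_map (geometric_realization K) euclideanreal (\<lambda>x. level_weight ?V x F)"
    if "F \<in> Pow ?V - {{}}" for F
  proof -
    have "finite F" "finite (?V - F)"
      using that fin finite_subset by auto
    then show ?thesis
      unfolding level_weight_def
      by (intro continuous_map_prod continuous_map_real_mult continuous_map_real_max
          continuous_map_diff coord) auto
  qed
  show "continuous_map (geometric_realization K) euclideanreal (\<lambda>x. to_subdivision ?V x F)" for F
  proof (cases "F \<in> Pow ?V - {{}}")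
    case True
    have "continuous_map (geometric_realization K) euclideanreal
        (\<lambda>x. level_weight ?V x F / (\<Sum>G\<in>Pow ?V - {{}}. level_weight ?V x G))"
      using pos fin
      by (intro continuous_map_real_divide continuous_map_sum weight True) (force+)
    then show ?thesis
      unfolding to_subdivision_def using True by (simp only: if_True)
  next
    case False
    then show ?thesis
      unfolding to_subdivision_def by (simp only: if_False continuous_map_const) simp
  qed
  fix x assume x: "x \<in> topspace (geometric_realization K)"
  note supp = supp_to_subdivision_realization[OF K x]
  show "to_subdivision ?V x \<in> topspace (geometric_realization (barycentric_subdivision K))"
  proof (rule geometric_realizationI)
    show "0 \<le> to_subdivision ?V x F" for F
      unfolding to_subdivision_def
      using less_imp_le[OF pos[OF x]] level_weight_nonneg[of x ?V F] geometric_realization_nonneg[OF x]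
      by auto
    show sub: "supp (to_subdivision ?V x) \<subseteq> Pow ?V - {{}}"
      using supp by blast
    show "supp (to_subdivision ?V x) \<in> barycentric_subdivision K"
      unfolding barycentric_subdivision_iff
    proof (intro conjI)
      show "finite (supp (to_subdivision ?V x))"
        using sub fin by (meson finite_Diff finite_Pow_iff finite_subset)
      show "supp (to_subdivision ?V x) \<subseteq> K - {{}}"
        using sub Union_supp_to_subdivision_subset[OF K x] geometric_realization_supp[OF x]
          finite_complex_subset[OF K] by blast
      show "Complete_Partial_Order.chain (\<subseteq>) (supp (to_subdivision ?V x))"
      proof (rule chainI, rule ccontr)
        fix F G assume F: "F \<in> supp (to_subdivision ?V x)" and G: "G \<in> supp (to_subdivision ?V x)"
          and "\<not> (F \<subseteq> G \<or> G \<subseteq> F)"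
        \<comment> \<open>Since \<open>F\<close> is a strict superlevel set containing
          \<open>v\<close> but not \<open>w\<close>, it forces \<open>x w < x v\<close>;
          \<open>G\<close> forces the reverse.\<close>
        then obtain v w where "v \<in> F - G" "w \<in> G - F" by blast
        moreover have "F \<subseteq> ?V" "G \<subseteq> ?V"
          using F G sub by blast+
        ultimately have "x w < x v" "x v < x w"
          using F G unfolding supp by blast+
        then show False by simp
      qed
    qed
    have "sum (to_subdivision ?V x) (Pow ?V - {{}}) =
        (\<Sum>F\<in>Pow ?V - {{}}. level_weight ?V x F / (\<Sum>G\<in>Pow ?V - {{}}. level_weight ?V x G))"
      by (rule sum.cong) (auto simp: to_subdivision_def)
    also have "\<dots> = 1"
      using pos[OF x] by (simp flip: sum_divide_distrib)
    finally show "sum (to_subdivision ?V x) (Pow ?V - {{}}) = 1" .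
  qed (use fin in auto)
qed

text \<open>The usual homeomorphism from the subdivision, affine on each simplex: the vertex
  \<open>F\<close> goes to the barycenter of the face \<open>F\<close>.\<close>

definition barycenter_map :: "'a set set \<Rightarrow> ('a set \<Rightarrow> real) \<Rightarrow> 'a \<Rightarrow> real" where
  "barycenter_map K y v = (\<Sum>F\<in>K - {{}}. if v \<in> F then y F / card F else 0)"

lemma finite_complex_finite_faces: "finite_complex K \<Longrightarrow> finite K"
  by (meson Sup_upper finite_Pow_iff finite_complex_def finite_subset subset_Pow_Union)

lemma supp_barycenter_map:
  assumes K: "finite_complex K" and y: "\<And>F. 0 \<le> y F" "supp y \<subseteq> K - {{}}"
  shows "supp (barycenter_map K y) = \<Union>(supp y)"
proof -
  have "barycenter_map K y v = 0 \<longleftrightarrow> (\<forall>F\<in>K - {{}}. v \<in> F \<longrightarrow> y F = 0)" for v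
    unfolding barycenter_map_def
  proof (subst sum_nonneg_eq_0_iff)
    show "(\<forall>F\<in>K - {{}}. (if v \<in> F then y F / card F else 0) = 0) \<longleftrightarrow>
        (\<forall>F\<in>K - {{}}. v \<in> F \<longrightarrow> y F = 0)"
    proof (intro ball_cong refl)
      fix F assume "F \<in> K - {{}}"
      then have "card F \<noteq> 0"
        using finite_complex_finite[OF K] by auto
      then show "(if v \<in> F then y F / card F else 0) = 0 \<longleftrightarrow> (v \<in> F \<longrightarrow> y F = 0)"
        by simp
    qed
  qed (use y finite_complex_finite_faces[OF K] in auto)
  then have "v \<in> supp (barycenter_map K y) \<longleftrightarrow> (\<exists>F\<in>K - {{}}. v \<in> F \<and> y F \<noteq> 0)" for v
    by simp
  also have "(\<exists>F\<in>K - {{}}. v \<in> F \<and> y F \<noteq> 0) \<longleftrightarrow> v \<in> \<Union>(supp y)" for v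
    using y(2) by auto
  finally show ?thesis
    by (rule set_eqI)
qed

lemma Union_face_of_subdivision:
  assumes "C \<in> barycentric_subdivision K" "C \<noteq> {}"
  shows "\<Union>C \<in> K"
  using chain_subset_Union_mem[of C] assms by (auto simp: barycentric_subdivision_iff)

lemma supp_barycenter_map_realization:
  assumes "finite_complex K" "y \<in> topspace (geometric_realization (barycentric_subdivision K))"
  shows "supp (barycenter_map K y) = \<Union>(supp y)"
proof (rule supp_barycenter_map[OF assms(1)])
  show "supp y \<subseteq> K - {{}}"
    using geometric_realization_supp[OF assms(2)] by (simp only: barycentric_subdivision_iff)
qed (rule geometric_realization_nonneg[OF assms(2)])

lemma Union_supp_subdivision_mem:
  assumes "y \<in> topspace (geometric_realization (barycentric_subdivision K))"
  shows "\<Union>(supp y) \<in> K"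
  using Union_face_of_subdivision geometric_realization_supp[OF assms]
    geometric_realization_supp_nonempty[OF assms] .

lemma continuous_map_barycenter_map:
  assumes K: "finite_complex K"
  shows "continuous_map (geometric_realization (barycentric_subdivision K)) (geometric_realization K)
           (barycenter_map K)"
  unfolding continuous_map_geometric_realization
proof (intro conjI allI funcsetI)
  let ?S = "geometric_realization (barycentric_subdivision K)"
  let ?V = "\<Union>K"
  have fin: "finite ?V" "finite (K - {{}})"
    using K finite_complex_finite_faces[OF K] by (auto simp: finite_complex_def)
  have coord: "continuous_map ?S euclideanreal (\<lambda>x. x v)" for v
    using continuous_map_coordinate[OF continuous_map_id] by simp
  have "continuous_map ?S euclideanreal (\<lambda>y. y F / card F)" if "F \<in> K - {{}}" for F
    using that finite_complex_finite[OF K]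
    by (intro continuous_map_real_divide coord) (auto)
  then show "continuous_map ?S euclideanreal (\<lambda>y. barycenter_map K y v)" for v
    unfolding barycenter_map_def using fin by (intro continuous_map_sum continuous_map_if_const)
  fix y assume y: "y \<in> topspace ?S"
  note supp = supp_barycenter_map_realization[OF K y]
  have nn: "0 \<le> y F" for F
    using geometric_realization_nonneg[OF y] .
  show "barycenter_map K y \<in> topspace (geometric_realization K)"
  proof (rule geometric_realizationI)
    show "0 \<le> barycenter_map K y v" for v
      unfolding barycenter_map_def using nn by (intro sum_nonneg) auto
    show "supp (barycenter_map K y) \<in> K"
      unfolding supp by (rule Union_supp_subdivision_mem[OF y])
    then show "supp (barycenter_map K y) \<subseteq> ?V"
      by blast
    have "sum (barycenter_map K y) ?V =
        (\<Sum>F\<in>K - {{}}. \<Sum>v\<in>?V. if v \<in> F then y F / card F else 0)"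
      unfolding barycenter_map_def by (rule sum.swap)
    \<comment> \<open>The weight of \<open>F\<close> is shared equally among its
      \<open>card F\<close> vertices, so summing over the vertices recovers it.\<close>
    also have "\<dots> = (\<Sum>F\<in>K - {{}}. y F)"
    proof (rule sum.cong)
      fix F assume F: "F \<in> K - {{}}"
      then have "?V \<inter> F = F" "card F \<noteq> 0"
        using finite_complex_finite[OF K] by auto
      then show "(\<Sum>v\<in>?V. if v \<in> F then y F / card F else 0) = y F"
        using fin(1) by (simp flip: sum.inter_restrict)
    qed simp
    also have "\<dots> = 1"
      using geometric_realization_sum[OF y fin(2)] by (simp add: Union_barycentric_subdivision)
    finally show "sum (barycenter_map K y) ?V = 1" .
  qed (use fin in auto)
qed

text \<open>The superlevel sets that carry weight consist of vertices of the support of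
  \<open>x\<close>, so the composite does not leave the face carrying \<open>x\<close> and a
  straight line joins the two maps.\<close>

lemma homotopic_barycenter_map_to_subdivision:
  assumes K: "finite_complex K"
  shows "homotopic_with (\<lambda>_. True) (geometric_realization K) (geometric_realization K)
           (barycenter_map K \<circ> to_subdivision (\<Union>K)) id"
proof (rule homotopic_straight_line[OF K])
  show "continuous_map (geometric_realization K) (geometric_realization K)
      (barycenter_map K \<circ> to_subdivision (\<Union>K))"
    using continuous_map_to_subdivision[OF K] continuous_map_barycenter_map[OF K]
    by (rule continuous_map_compose)
  fix x assume x: "x \<in> topspace (geometric_realization K)"
  then have "to_subdivision (\<Union>K) x \<in> topspace (geometric_realization (barycentric_subdivision K))"
    using continuous_map_to_subdivision[OF K] by (auto simp: continuous_map_geometric_realization)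
  then have "supp ((barycenter_map K \<circ> to_subdivision (\<Union>K)) x) \<subseteq> supp x"
    using supp_barycenter_map_realization[OF K] Union_supp_to_subdivision_subset[OF K x] by simp
  then show "supp ((barycenter_map K \<circ> to_subdivision (\<Union>K)) x) \<union> supp (id x) \<in> K"
    using geometric_realization_supp[OF x] by (simp add: Un_absorb1)
qed simp

text \<open>For a straight line, the superlevel sets of the barycenter point must be comparable with
  the members of the chain \<open>supp y\<close>.\<close>

lemma homotopic_to_subdivision_barycenter_map:
  assumes K: "finite_complex K"
  shows "homotopic_with (\<lambda>_. True) (geometric_realization (barycentric_subdivision K))
           (geometric_realization (barycentric_subdivision K))
           (to_subdivision (\<Union>K) \<circ> barycenter_map K) id"
proof (rule homotopic_straight_line[OF finite_complex_barycentric_subdivision[OF K]])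
  let ?S = "geometric_realization (barycentric_subdivision K)"
  show "continuous_map ?S ?S (to_subdivision (\<Union>K) \<circ> barycenter_map K)"
    using continuous_map_barycenter_map[OF K] continuous_map_to_subdivision[OF K]
    by (rule continuous_map_compose)
  fix y assume y: "y \<in> topspace ?S"
  let ?x = "barycenter_map K y"
  have x: "?x \<in> topspace (geometric_realization K)"
    using y continuous_map_barycenter_map[OF K] by (auto simp: continuous_map_geometric_realization)
  then have "to_subdivision (\<Union>K) ?x \<in> topspace ?S"
    using continuous_map_to_subdivision[OF K] by (auto simp: continuous_map_geometric_realization)
  then have tx: "supp (to_subdivision (\<Union>K) ?x) \<in> barycentric_subdivision K"
    by (rule geometric_realization_supp)
  have sy: "supp y \<in> barycentric_subdivision K"
    using y by (rule geometric_realization_supp)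
  have cmp: "F \<subseteq> G \<or> G \<subseteq> F" if F: "F \<in> supp (to_subdivision (\<Union>K) ?x)" and G: "G \<in> supp y" for F G
  proof (rule ccontr)
    assume "\<not> (F \<subseteq> G \<or> G \<subseteq> F)"
    then obtain v w where vw: "v \<in> F - G" "w \<in> G - F" by blast
    have "w \<in> \<Union>K"
      using G vw Union_supp_subdivision_mem[OF y] by blast
    then have "?x w < ?x v"
      using F vw unfolding supp_to_subdivision_realization[OF K x] by blast
    \<comment> \<open>A face \<open>H\<close> of the chain that contains \<open>v\<close> is not
      contained in \<open>G\<close>, hence contains \<open>G\<close> and with it \<open>w\<close>.
      So every contribution to \<open>?x v\<close> also occurs in \<open>?x w\<close>.\<close>
    moreover have "?x v \<le> ?x w"
      unfolding barycenter_map_def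
    proof (rule sum_mono)
      fix H assume "H \<in> K - {{}}"
      have "w \<in> H" if "v \<in> H" "y H \<noteq> 0"
      proof -
        have "G \<subseteq> H \<or> H \<subseteq> G"
          using sy G that unfolding barycentric_subdivision_iff Complete_Partial_Order.chain_def by blast
        then show ?thesis
          using vw that by blast
      qed
      then show "(if v \<in> H then y H / card H else 0) \<le> (if w \<in> H then y H / card H else 0)"
        using geometric_realization_nonneg[OF y, of H] by (cases "y H = 0") auto
    qed
    ultimately show False by simp
  qed
  have "Complete_Partial_Order.chain (\<subseteq>) (supp (to_subdivision (\<Union>K) ?x) \<union> supp y)"
    using tx sy cmp unfolding barycentric_subdivision_iff Complete_Partial_Order.chain_def by blast
  then show "supp ((to_subdivision (\<Union>K) \<circ> barycenter_map K) y) \<union> supp (id y)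
      \<in> barycentric_subdivision K"
    using tx sy by (simp add: barycentric_subdivision_iff)
qed simp

lemma barycentric_subdivision_homotopy_equivalent:
  assumes "finite_complex K"
  shows "geometric_realization (barycentric_subdivision K) homotopy_equivalent_space
           geometric_realization K"
  unfolding homotopy_equivalent_space_def
  using assms continuous_map_to_subdivision continuous_map_barycenter_map
    homotopic_barycenter_map_to_subdivision homotopic_to_subdivision_barycenter_map by blast

section \<open>Comparing a complex with a poset\<close>

text \<open>As for inverses in a monoid, \<open>l\<close> is homotopic to
  \<open>l \<circ> f \<circ> r\<close>, hence to \<open>r\<close>, and so is also a right
  inverse.\<close>

lemma homotopy_equivalent_space_left_right_inverse:
  assumes f: "continuous_map X Y f" and l: "continuous_map Y X l" and r: "continuous_map Y X r"
    and lf: "homotopic_with (\<lambda>_. True) X X (l \<circ> f) id"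
    and fr: "homotopic_with (\<lambda>_. True) Y Y (f \<circ> r) id"
  shows "X homotopy_equivalent_space Y"
proof -
  have "homotopic_with (\<lambda>_. True) Y X (l \<circ> (f \<circ> r)) (l \<circ> id)"
    by (rule homotopic_with_compose_continuous_map_left[OF fr l]) simp
  moreover have "homotopic_with (\<lambda>_. True) Y X ((l \<circ> f) \<circ> r) (id \<circ> r)"
    by (rule homotopic_with_compose_continuous_map_right[OF lf r]) simp
  ultimately have "homotopic_with (\<lambda>_. True) Y X l r"
    by (metis comp_assoc comp_id homotopic_with_symD homotopic_with_trans id_comp)
  then have "homotopic_with (\<lambda>_. True) Y Y (f \<circ> l) (f \<circ> r)"
    by (rule homotopic_with_compose_continuous_map_left[OF _ f]) simp
  then have "homotopic_with (\<lambda>_. True) Y Y (f \<circ> l) id"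
    using fr homotopic_with_trans by blast
  then show ?thesis
    unfolding homotopy_equivalent_space_def using f l lf by blast
qed

text \<open>\<open>gf\<close> keeps \<open>g \<circ> f\<close> within the face carrying a point,
  which yields a left inverse. \<open>fg\<close> compares with the least element of
  \<open>F\<close>, the vertex chosen by the first vertex map, which yields a right inverse.\<close>

theorem barycentric_subdivision_homotopy_equivalent_order_complex:
  fixes K :: "'b set set" and P :: "'a set"
  assumes K: "finite_complex K" and P: "finite P"
    and trans: "\<And>x y z. le x y \<Longrightarrow> le y z \<Longrightarrow> le x z"
    and g: "\<And>F. F \<in> order_complex P le \<Longrightarrow> g ` F \<in> K"
    and f: "\<And>C. C \<in> K - {{}} \<Longrightarrow> f C \<in> P"
    and f_antimono: "\<And>C D. C \<in> K - {{}} \<Longrightarrow> D \<in> K - {{}} \<Longrightarrow> C \<subseteq> D \<Longrightarrow> le (f D) (f C)"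
    and gf: "\<And>C. C \<in> K - {{}} \<Longrightarrow> g (f C) \<in> C"
    and fg: "\<And>F x. F \<in> order_complex P le \<Longrightarrow> x \<in> F \<Longrightarrow> (\<And>y. y \<in> F \<Longrightarrow> le x y) \<Longrightarrow>
      le x (f (g ` F))"
  shows "geometric_realization (barycentric_subdivision K) homotopy_equivalent_space
           geometric_realization (order_complex P le)"
proof -
  define D where "D = order_complex P le"
  let ?K = "geometric_realization K" and ?D = "geometric_realization D"
  let ?sK = "geometric_realization (barycentric_subdivision K)"
  let ?sD = "geometric_realization (barycentric_subdivision D)"
  have D: "finite_complex D"
    unfolding D_def by (rule finite_complex_order_complex[OF P])
  note sK = finite_complex_barycentric_subdivision[OF K]
  note sD = finite_complex_barycentric_subdivision[OF D]
  \<comment> \<open>\<open>fm\<close> and \<open>gm\<close> are the simplicial maps of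
    \<open>f\<close> and \<open>g\<close>; \<open>gs\<close> is the map that \<open>g\<close>
    induces between the subdivisions.\<close>
  define fm where "fm = pushforward (\<Union>(barycentric_subdivision K)) f"
  define gm where "gm = pushforward (\<Union>D) g"
  define gs where "gs = pushforward (\<Union>(barycentric_subdivision D)) (image g)"
  have f_chain: "f ` C \<in> D" if C: "C \<in> barycentric_subdivision K" for C
  proof -
    have "Complete_Partial_Order.chain le (f ` C)"
    proof (rule chainI, clarify)
      fix S T assume ST: "S \<in> C" "T \<in> C" and n: "\<not> le (f T) (f S)"
      have "S \<subseteq> T \<or> T \<subseteq> S" "S \<in> K - {{}}" "T \<in> K - {{}}"
        using C ST unfolding barycentric_subdivision_iff Complete_Partial_Order.chain_def by blast+
      then show "le (f S) (f T)"
        using f_antimono n by blast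
    qed
    then show ?thesis
      using C f by (auto simp: D_def order_complex_def barycentric_subdivision_iff)
  qed
  have g_face: "g ` F \<in> K - {{}}" if "F \<in> D - {{}}" for F
    using g that by (auto simp: D_def)
  have g_chain: "image g ` C \<in> barycentric_subdivision K" if C: "C \<in> barycentric_subdivision D" for C
  proof -
    have "Complete_Partial_Order.chain (\<subseteq>) (image g ` C)"
    proof (rule chainI)
      fix S T assume "S \<in> image g ` C" "T \<in> image g ` C"
      then obtain F G where FG: "F \<in> C" "G \<in> C" "S = g ` F" "T = g ` G"
        by blast
      then have "F \<subseteq> G \<or> G \<subseteq> F"
        using C unfolding barycentric_subdivision_iff Complete_Partial_Order.chain_def by blast
      then show "S \<subseteq> T \<or> T \<subseteq> S"
        using FG(3,4) image_mono by metis
    qed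
    moreover have "image g ` C \<subseteq> K - {{}}"
      using C g_face unfolding barycentric_subdivision_iff by (meson image_subset_iff subsetD)
    ultimately show ?thesis
      using C by (simp add: barycentric_subdivision_iff)
  qed
  have fm: "continuous_map ?sK ?D fm"
    unfolding fm_def using f_chain by (rule continuous_map_pushforward[OF sK])
  have gm: "continuous_map ?D ?K gm"
    unfolding gm_def D_def[symmetric] using g by (intro continuous_map_pushforward[OF D]) (simp add: D_def)
  have gs: "continuous_map ?sD ?sK gs"
    unfolding gs_def using g_chain by (rule continuous_map_pushforward[OF sD])
  note tK = continuous_map_to_subdivision[OF K]
  note tD = continuous_map_to_subdivision[OF D]

  \<comment> \<open>By \<open>gf\<close> each \<open>C\<close> in \<open>supp y\<close> goes to one
    of its own vertices, so both image points lie in the face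
    \<open>\<Union>(supp y)\<close>.\<close>
  have "homotopic_with (\<lambda>_. True) ?sK ?K (gm \<circ> fm) (barycenter_map K)"
  proof (rule homotopic_straight_line[OF K])
    show "continuous_map ?sK ?K (gm \<circ> fm)"
      using fm gm by (rule continuous_map_compose)
    show "continuous_map ?sK ?K (barycenter_map K)"
      by (rule continuous_map_barycenter_map[OF K])
    fix y assume y: "y \<in> topspace ?sK"
    have "fm y \<in> topspace ?D"
      using fm y by (auto simp: continuous_map_def)
    then have "supp (gm (fm y)) = g ` f ` supp y"
      unfolding gm_def fm_def supp_pushforward_realization[OF sK y, symmetric]
      by (rule supp_pushforward_realization[OF D])
    moreover have "supp y \<subseteq> K - {{}}"
      using geometric_realization_supp[OF y] by (simp add: barycentric_subdivision_iff)
    ultimately have "supp (gm (fm y)) \<subseteq> \<Union>(supp y)"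
      using gf by (simp add: image_subset_iff) blast
    then show "supp ((gm \<circ> fm) y) \<union> supp (barycenter_map K y) \<in> K"
      using Union_supp_subdivision_mem[OF y]
      by (simp add: supp_barycenter_map_realization[OF K y] Un_absorb1)
  qed
  \<comment> \<open>Composing with the homotopy inverse of the barycenter map turns the comparison
    into one with the identity.\<close>
  then have "homotopic_with (\<lambda>_. True) ?sK ?sK (to_subdivision (\<Union>K) \<circ> (gm \<circ> fm))
      (to_subdivision (\<Union>K) \<circ> barycenter_map K)"
    by (rule homotopic_with_compose_continuous_map_left[OF _ tK]) simp
  then have left: "homotopic_with (\<lambda>_. True) ?sK ?sK ((to_subdivision (\<Union>K) \<circ> gm) \<circ> fm) id"
    using homotopic_to_subdivision_barycenter_map[OF K]
    unfolding comp_assoc by (rule homotopic_with_trans)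

  \<comment> \<open>The first vertex of the chain \<open>F\<close>: its least element, which exists
    because \<open>F\<close> is finite and nonempty.\<close>
  define m where "m = (\<lambda>F. SOME x. x \<in> F \<and> (\<forall>y\<in>F. le x y))"
  have m: "m F \<in> F" "\<And>y. y \<in> F \<Longrightarrow> le (m F) y" if F: "F \<in> D - {{}}" for F
  proof -
    have "\<exists>x. x \<in> F \<and> (\<forall>y\<in>F. le x y)"
      using chain_least[of F le] F trans by (auto simp: D_def order_complex_def)
    from someI_ex[OF this] show "m F \<in> F" "\<And>y. y \<in> F \<Longrightarrow> le (m F) y"
      by (simp_all add: m_def)
  qed
  define mm where "mm = pushforward (\<Union>(barycentric_subdivision D)) m"
  define fgm where "fgm = pushforward (\<Union>(barycentric_subdivision D)) (\<lambda>F. f (g ` F))"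
  \<comment> \<open>Reversing inclusion leaves the order complex unchanged but makes both vertex
    maps monotone: a larger face has a smaller least element, and \<open>f\<close> is
    order-reversing.\<close>
  have "order_complex (D - {{}}) (\<lambda>F G. G \<subseteq> F) = barycentric_subdivision D"
    by (auto simp: barycentric_subdivision_def order_complex_def Complete_Partial_Order.chain_def)
  note this[simp]
  have DP: "F \<subseteq> P" if "F \<in> D" for F
    using that by (simp add: D_def order_complex_def)
  have "homotopic_with (\<lambda>_. True) (geometric_realization (order_complex (D - {{}}) (\<lambda>F G. G \<subseteq> F)))
      (geometric_realization (order_complex P le))
      (pushforward (\<Union>(order_complex (D - {{}}) (\<lambda>F G. G \<subseteq> F))) m)
      (pushforward (\<Union>(order_complex (D - {{}}) (\<lambda>F G. G \<subseteq> F))) (\<lambda>F. f (g ` F)))"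
  proof (rule homotopic_pushforward_le)
    show "finite (D - {{}})"
      using finite_complex_finite_faces[OF D] by simp
    show "m F \<in> P" if "F \<in> D - {{}}" for F
      using m(1)[OF that] that DP by blast
    show "f (g ` F) \<in> P" if "F \<in> D - {{}}" for F
      using f g_face that by blast
    show "le (m F) (m G)" if "F \<in> D - {{}}" "G \<in> D - {{}}" "G \<subseteq> F" for F G
      using m that by blast
    show "le (f (g ` F)) (f (g ` G))" if "F \<in> D - {{}}" "G \<in> D - {{}}" "G \<subseteq> F" for F G
      using f_antimono g_face that by (meson image_mono)
    show "le (m F) (f (g ` F))" if "F \<in> D - {{}}" for F
      using fg[of F "m F"] m that by (auto simp: D_def)
  qed (use P trans in auto)
  then have 1: "homotopic_with (\<lambda>_. True) ?sD ?D fgm mm"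
    unfolding fgm_def mm_def D_def[symmetric] by (simp add: homotopic_with_sym)
  \<comment> \<open>Both maps send \<open>y\<close> to a point with the same support, which is a
    face.\<close>
  have 2: "homotopic_with (\<lambda>_. True) ?sD ?D (fm \<circ> gs) fgm"
  proof (rule homotopic_straight_line[OF D])
    show "continuous_map ?sD ?D (fm \<circ> gs)"
      using gs fm by (rule continuous_map_compose)
    show "continuous_map ?sD ?D fgm"
      using 1 by (rule homotopic_with_imp_continuous_maps[THEN conjunct1])
    fix y assume y: "y \<in> topspace ?sD"
    have gsy: "gs y \<in> topspace ?sK"
      using gs y by (auto simp: continuous_map_def)
    then have "supp (fm (gs y)) = f ` image g ` supp y"
      unfolding gs_def fm_def supp_pushforward_realization[OF sD y, symmetric]
      by (rule supp_pushforward_realization[OF sK])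
    moreover have "supp (fgm y) = f ` image g ` supp y"
      unfolding fgm_def supp_pushforward_realization[OF sD y] by (simp add: image_image)
    moreover have "f ` image g ` supp y \<in> D"
      using f_chain g_chain geometric_realization_supp[OF y] by blast
    ultimately show "supp ((fm \<circ> gs) y) \<union> supp (fgm y) \<in> D"
      by simp
  qed
  \<comment> \<open>Each superlevel set is sent to one of its own members, so the image stays in the
    face carrying \<open>x\<close>.\<close>
  have 3: "homotopic_with (\<lambda>_. True) ?D ?D (mm \<circ> to_subdivision (\<Union>D)) id"
  proof (rule homotopic_straight_line[OF D])
    show "continuous_map ?D ?D (mm \<circ> to_subdivision (\<Union>D))"
      using tD 1[THEN homotopic_with_imp_continuous_maps, THEN conjunct2]
      by (rule continuous_map_compose)
    fix x assume x: "x \<in> topspace ?D"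
    let ?y = "to_subdivision (\<Union>D) x"
    have y: "?y \<in> topspace ?sD"
      using tD x by (auto simp: continuous_map_def)
    have "supp ?y \<subseteq> D - {{}}"
      using geometric_realization_supp[OF y] by (simp add: barycentric_subdivision_iff)
    then have "m ` supp ?y \<subseteq> \<Union>(supp ?y)"
      using m(1) by blast
    then have "supp (mm ?y) \<subseteq> supp x"
      using Union_supp_to_subdivision_subset[OF D x]
      unfolding mm_def supp_pushforward_realization[OF sD y] by blast
    then show "supp ((mm \<circ> to_subdivision (\<Union>D)) x) \<union> supp (id x) \<in> D"
      using geometric_realization_supp[OF x] by (simp add: Un_absorb1)
  qed simp
  \<comment> \<open>Chaining the three homotopies makes
    \<open>gs \<circ> to_subdivision (\<Union>D)\<close> a right homotopy inverse of
    \<open>fm\<close>.\<close>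
  have "homotopic_with (\<lambda>_. True) ?D ?D ((fm \<circ> gs) \<circ> to_subdivision (\<Union>D))
      (mm \<circ> to_subdivision (\<Union>D))"
    using homotopic_with_trans[OF 2 1]
    by (rule homotopic_with_compose_continuous_map_right[OF _ tD]) simp
  then have right: "homotopic_with (\<lambda>_. True) ?D ?D (fm \<circ> (gs \<circ> to_subdivision (\<Union>D))) id"
    using 3 unfolding comp_assoc by (rule homotopic_with_trans)
  have "?sK homotopy_equivalent_space ?D"
    using fm continuous_map_compose[OF gm tK] continuous_map_compose[OF tD gs] left right
    by (rule homotopy_equivalent_space_left_right_inverse)
  then show ?thesis
    by (simp add: D_def)
qed

section \<open>Partial sums of compositions\<close>

text \<open>The strict bound leaves out the full prefix, while the empty prefix contributes
  0.\<close>

definition partial_sums :: "nat list \<Rightarrow> nat set" where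
  "partial_sums c = {sum_list (take i c) |i. i < length c}"

lemma sum_list_concat_nat: "sum_list (concat css) = sum_list (map sum_list css)"
  for css :: "nat list list"
  by (induction css) auto

lemma comp_le_sum_list: "comp_le c d \<Longrightarrow> sum_list d = sum_list c"
  by (auto simp: comp_le_def sum_list_concat_nat)

text \<open>The first \<open>i\<close> runs concatenate to a prefix of \<open>c\<close>, which is
  proper because the remaining runs are nonempty.\<close>

lemma comp_le_partial_sums:
  assumes "comp_le c d"
  shows "partial_sums d \<subseteq> partial_sums c"
proof
  obtain css where css: "[] \<notin> set css" "c = concat css" "d = map sum_list css"
    using assms by (auto simp: comp_le_def)
  fix s assume "s \<in> partial_sums d"
  then obtain i where i: "i < length css" "s = sum_list (take i d)"
    by (auto simp: partial_sums_def css)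
  define ps where "ps = concat (take i css)"
  have "s = sum_list ps"
    by (simp add: i ps_def css sum_list_concat_nat take_map)
  moreover have c: "c = ps @ concat (drop i css)"
    by (simp add: css(2) ps_def flip: concat_append)
  moreover have "css ! i \<in> set css" "css ! i \<in> set (drop i css)"
    using i(1) by (simp, metis Cons_nth_drop_Suc list.set_intros(1))
  then have "concat (drop i css) \<noteq> []"
    using css(1) by fastforce
  ultimately show "s \<in> partial_sums c"
    unfolding partial_sums_def by (auto intro!: exI[of _ "length ps"])
qed

text \<open>With positive entries a prefix is determined by its sum, so the partial sums of
  \<open>d\<close> tell where to cut \<open>c\<close> into runs. The induction cuts off one run at a
  time.\<close>

lemma comp_leI:
  assumes "c \<noteq> []" "d \<noteq> []" "\<And>x. x \<in> set c \<Longrightarrow> 0 < x" "\<And>x. x \<in> set d \<Longrightarrow> 0 < x"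
    and "sum_list c = sum_list d" "partial_sums d \<subseteq> partial_sums c"
  shows "comp_le c d"
  using assms
proof (induction d arbitrary: c)
  case (Cons x d)
  show ?case
  proof (cases "d = []")
    case True
    then show ?thesis
      using Cons.prems by (auto simp: comp_le_def intro!: exI[of _ "[c]"])
  next
    case False
    \<comment> \<open>The one-entry prefix is proper because \<open>d\<close> is nonempty; its sum
      locates the end of the first run of \<open>c\<close>.\<close>
    have "x \<in> partial_sums (x # d)"
      using False by (auto simp: partial_sums_def intro!: exI[of _ 1])
    then obtain i where i: "i < length c" "x = sum_list (take i c)"
      using Cons.prems(6) by (auto simp: partial_sums_def)
    have "0 < x"
      using Cons.prems(4) by simp
    then have "take i c \<noteq> []"
      using i(2) by (intro notI) (simp only: sum_list.Nil)
    have split: "sum_list c = sum_list (take i c) + sum_list (drop i c)"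
      by (metis append_take_drop_id sum_list_append)
    have "comp_le (drop i c) d"
    proof (rule Cons.IH)
      show "drop i c \<noteq> []" "d \<noteq> []"
        using i False by auto
      show "sum_list (drop i c) = sum_list d"
        using split Cons.prems(5) i by simp
      show "0 < y" if "y \<in> set (drop i c)" for y
        using that Cons.prems(3) in_set_dropD by metis
      show "0 < y" if "y \<in> set d" for y
        using that Cons.prems(4) by simp
      show "partial_sums d \<subseteq> partial_sums (drop i c)"
      proof
        fix s assume "s \<in> partial_sums d"
        then obtain j where "j < length d" "s = sum_list (take j d)"
          by (auto simp: partial_sums_def)
        then have "x + s \<in> partial_sums (x # d)"
          by (auto simp: partial_sums_def intro!: exI[of _ "Suc j"])
        then obtain k where k: "k < length c" "x + s = sum_list (take k c)"
          using Cons.prems(6) by (auto simp: partial_sums_def)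
        \<comment> \<open>A shorter prefix would miss the positive entry \<open>c ! k\<close> and
          have a sum below \<open>x\<close>, yet its sum is \<open>x + s\<close>.\<close>
        have "i \<le> k"
        proof (rule ccontr)
          assume "\<not> i \<le> k"
          then have "take i c = take k c @ take (i - k) (drop k c)"
            by (metis le_add_diff_inverse nat_le_linear take_add)
          moreover have "c ! k \<in> set (take (i - k) (drop k c))"
            using k(1) \<open>\<not> i \<le> k\<close> by (auto simp: in_set_conv_nth intro!: exI[of _ 0])
          then have "c ! k \<le> sum_list (take (i - k) (drop k c))"
            by (simp add: member_le_sum_list)
          moreover have "0 < c ! k"
            using Cons.prems(3) k(1) by simp
          ultimately show False
            using i(2) k(2) by simp
        qed
        then have "take k c = take i c @ take (k - i) (drop i c)"
          by (metis le_add_diff_inverse take_add)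
        then have "s = sum_list (take (k - i) (drop i c))"
          using k i by simp
        then show "s \<in> partial_sums (drop i c)"
          using k(1) \<open>i \<le> k\<close> by (auto simp: partial_sums_def intro!: exI[of _ "k - i"])
      qed
    qed
    then obtain css where "[] \<notin> set css" "concat css = drop i c" "map sum_list css = d"
      by (auto simp: comp_le_def)
    then show ?thesis
      unfolding comp_le_def using i \<open>take i c \<noteq> []\<close>
      by (intro exI[of _ "take i c # css"]) auto
  qed
qed simp

lemma composition_pos: "composition n c \<Longrightarrow> x \<in> set c \<Longrightarrow> 0 < x"
  unfolding composition_def pointed_composition_def
  by (metis One_nat_def Suc_le_eq Un_iff append_butlast_last_id empty_iff empty_set
      insert_iff list.simps(15) set_append)

text \<open>The omitted tail contains a positive entry. This later keeps \<open>{1..n}\<close>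
  itself out of \<open>rank_selected\<close>.\<close>

lemma partial_sums_less:
  assumes "composition n c" "s \<in> partial_sums c"
  shows "s < n"
proof -
  obtain i where i: "i < length c" "s = sum_list (take i c)"
    using assms by (auto simp: partial_sums_def)
  have "c ! i \<in> set (drop i c)"
    using i(1) by (metis Cons_nth_drop_Suc list.set_intros(1))
  then have "c ! i \<le> sum_list (drop i c)"
    by (simp add: member_le_sum_list)
  moreover have "0 < c ! i"
    using composition_pos[OF assms(1)] i(1) by simp
  moreover have "sum_list c = sum_list (take i c) + sum_list (drop i c)"
    by (metis append_take_drop_id sum_list_append)
  ultimately show ?thesis
    using assms(1) i by (simp add: composition_def pointed_composition_def)
qed

section \<open>Chains of sets and pointed partitions\<close>

text \<open>The last block never enters \<open>op_face\<close>, so appending one turns the union of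
  the former blocks into a new vertex.\<close>

lemma op_face_snoc:
  assumes "Cs \<noteq> []"
  shows "op_face (Cs @ [S]) = insert (\<Union>(set Cs)) (op_face Cs)"
proof -
  have len: "1 \<le> length Cs"
    using assms by (cases Cs) auto
  have "op_face (Cs @ [S]) = (\<lambda>i. \<Union>(set (take i (Cs @ [S])))) ` {1..<Suc (length Cs)}"
    by (auto simp: op_face_def)
  also have "\<dots> = (\<lambda>i. \<Union>(set (take i Cs))) ` {1..<Suc (length Cs)}"
    by (rule image_cong) auto
  also have "{1..<Suc (length Cs)} = insert (length Cs) {1..<length Cs}"
    using len by auto
  also have "(\<lambda>i. \<Union>(set (take i Cs))) ` \<dots> = insert (\<Union>(set Cs)) (op_face Cs)"
    by (auto simp: op_face_def)
  finally show ?thesis .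
qed

text \<open>For a chain these are the smallest nonempty member and the differences of successive
  members. The formula avoids enumerating the chain, which makes refinement arguments
  direct.\<close>

definition membership_blocks :: "'a set set \<Rightarrow> 'a set set" where
  "membership_blocks C = (\<lambda>x. {y \<in> \<Union>C. \<forall>S\<in>C. x \<in> S \<longleftrightarrow> y \<in> S}) ` \<Union>C"

text \<open>All old points lie in \<open>S\<close>, so \<open>S\<close> separates none of them; the
  new points lie in \<open>S\<close> only and form a single class.\<close>

lemma membership_blocks_insert:
  assumes "\<Union>C \<subset> S"
  shows "membership_blocks (insert S C) = insert (S - \<Union>C) (membership_blocks C)"
proof -
  define cls where "cls = (\<lambda>D x. {y \<in> \<Union>D. \<forall>S\<in>D. x \<in> S \<longleftrightarrow> (y::'a) \<in> S})"
  have "cls (insert S C) x = cls C x" if "x \<in> \<Union>C" for x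
    using that assms unfolding cls_def by blast
  then have 1: "cls (insert S C) ` \<Union>C = cls C ` \<Union>C"
    by (rule image_cong[OF refl])
  have "cls (insert S C) x = S - \<Union>C" if "x \<in> S - \<Union>C" for x
    using that assms unfolding cls_def by blast
  then have "cls (insert S C) ` (S - \<Union>C) = (\<lambda>_. S - \<Union>C) ` (S - \<Union>C)"
    by (rule image_cong[OF refl])
  also have "\<dots> = {S - \<Union>C}"
    using assms by blast
  finally have 2: "cls (insert S C) ` (S - \<Union>C) = {S - \<Union>C}" .
  have "membership_blocks (insert S C) = cls (insert S C) ` (\<Union>C \<union> (S - \<Union>C))"
    using assms unfolding membership_blocks_def cls_def by (intro arg_cong2[of _ _ _ _ image]) auto
  also have "\<dots> = insert (S - \<Union>C) (cls C ` \<Union>C)"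
    unfolding image_Un 1 2 by simp
  finally show ?thesis
    by (simp only: membership_blocks_def cls_def)
qed

text \<open>Remove the largest member \<open>S\<close> of the chain, partition \<open>S\<close> by
  induction, and append \<open>U - S\<close>. The ground set \<open>U\<close> is general because the
  induction replaces it by \<open>S\<close>.\<close>

lemma ordered_partition_of_chain:
  assumes "finite C" "Complete_Partial_Order.chain (\<subseteq>) C" "\<And>S. S \<in> C \<Longrightarrow> S \<noteq> {} \<and> S \<subset> U"
    and "U \<noteq> {}"
  shows "\<exists>Cs. Cs \<noteq> [] \<and> {} \<notin> set Cs \<and> sorted_wrt disjnt Cs \<and> \<Union>(set Cs) = U \<and> op_face Cs = C \<and>
    set (butlast Cs) = membership_blocks C \<and> last Cs = U - \<Union>C"
  using assms
proof (induction "card C" arbitrary: C U)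
  case 0
  then have "C = {}" by simp
  then show ?case
    using 0 by (intro exI[of _ "[U]"]) (auto simp: op_face_def membership_blocks_def)
next
  case (Suc k)
  then have "C \<noteq> {}" by auto
  define S where "S = \<Union>C"
  have S: "S \<in> C"
    unfolding S_def using Suc.prems \<open>C \<noteq> {}\<close> by (intro chain_subset_Union_mem)
  define C' where "C' = C - {S}"
  have C: "C = insert S C'" "finite C'" "k = card C'"
    using S Suc by (auto simp: C'_def)
  have ch: "Complete_Partial_Order.chain (\<subseteq>) C'"
    using Suc.prems(2) unfolding C'_def by (rule chain_subset) blast
  have psub: "T \<subset> S" if "T \<in> C'" for T
    using that by (auto simp: C'_def S_def)
  have "\<Union>C' \<subset> S"
  proof (cases "C' = {}")
    case True
    then show ?thesis using Suc.prems(3)[OF S] by auto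
  next
    case False
    show ?thesis
      by (rule psub[OF chain_subset_Union_mem[OF C(2) False ch]])
  qed
  have SU: "S \<noteq> {}" "S \<subset> U"
    using Suc.prems(3)[OF S] by auto
  obtain Ds where Ds: "Ds \<noteq> []" "{} \<notin> set Ds" "sorted_wrt disjnt Ds" "\<Union>(set Ds) = S"
      "op_face Ds = C'" "set (butlast Ds) = membership_blocks C'" "last Ds = S - \<Union>C'"
    using Suc.hyps(1)[OF C(3) C(2) ch _ SU(1)] psub Suc.prems(3) C(1) by blast
  let ?Cs = "Ds @ [U - S]"
  have "set Ds = insert (last Ds) (set (butlast Ds))"
    using Ds(1) by (metis append_butlast_last_id list.simps(15) rotate1.simps(2) set_rotate1)
  then have "set (butlast ?Cs) = membership_blocks C"
    using Ds membership_blocks_insert[OF \<open>\<Union>C' \<subset> S\<close>] by (simp add: C(1))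
  moreover have "op_face ?Cs = C"
    using op_face_snoc[OF Ds(1)] Ds(4,5) by (simp add: C(1))
  moreover have "{} \<notin> set ?Cs"
    using Ds(2) SU by auto
  moreover have "sorted_wrt disjnt ?Cs"
    using Ds(3,4) by (auto simp: sorted_wrt_append disjnt_def)
  moreover have "\<Union>(set ?Cs) = U"
    using Ds(4) SU by auto
  moreover have "last ?Cs = U - \<Union>C"
    by (simp add: S_def)
  moreover have "?Cs \<noteq> []"
    by simp
  ultimately show ?case
    by (intro exI[of _ ?Cs] conjI)
qed

section \<open>Ordered set partitions as chains of sets of selected sizes\<close>

lemma card_Union_sorted_wrt_disjnt:
  assumes "sorted_wrt disjnt Cs" "\<And>S. S \<in> set Cs \<Longrightarrow> finite S"
  shows "card (\<Union>(set Cs)) = sum_list (map card Cs)"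
  using assms
proof (induction Cs)
  case (Cons S Cs)
  then have "card (S \<union> \<Union>(set Cs)) = card S + card (\<Union>(set Cs))"
    by (intro card_Un_disjoint) (auto simp: disjnt_def)
  then show ?case using Cons by simp
qed simp

text \<open>Disjointness makes partial sums of the type the sizes of initial unions; the extra 0 is
  the empty prefix, which \<open>op_face\<close> omits.\<close>

lemma partial_sums_op_type:
  assumes "Cs \<noteq> []" "sorted_wrt disjnt Cs" "finite (\<Union>(set Cs))"
  shows "partial_sums (op_type Cs) = insert 0 (card ` op_face Cs)"
proof -
  have "sum_list (take i (op_type Cs)) = card (\<Union>(set (take i Cs)))" for i
  proof -
    have "finite S" if "S \<in> set (take i Cs)" for S
      using that assms(3) by (meson Union_upper in_set_takeD finite_subset)
    then show ?thesis
      using card_Union_sorted_wrt_disjnt[OF sorted_wrt_take[OF assms(2)]]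
      by (simp add: op_type_def take_map)
  qed
  then have "partial_sums (op_type Cs) = (\<lambda>i. card (\<Union>(set (take i Cs)))) ` {..<length Cs}"
    by (auto simp: partial_sums_def op_type_def)
  moreover have "{..<length Cs} = insert 0 {1..<length Cs}"
    using assms(1) by (cases Cs) auto
  moreover have "op_face Cs = (\<lambda>i. \<Union>(set (take i Cs))) ` {1..<length Cs}"
    by (auto simp: op_face_def)
  ultimately show ?thesis
    by (simp add: image_image)
qed

text \<open>A rank-selected part of the Boolean lattice. Nonemptiness is required separately because
  0 is always among the partial sums of a nonempty list.\<close>

definition rank_selected :: "nat \<Rightarrow> nat list \<Rightarrow> nat set set" where
  "rank_selected n c = {S. S \<subseteq> {1..n} \<and> S \<noteq> {} \<and> card S \<in> partial_sums c}"

lemma finite_rank_selected: "finite (rank_selected n c)"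
  by (rule finite_subset[of _ "Pow {1..n}"]) (auto simp: rank_selected_def)

text \<open>No member of \<open>C\<close> is all of \<open>{1..n}\<close>, so even the last block is
  nonempty and the type has positive entries. Its partial sums are 0 and the sizes of members of
  \<open>C\<close>, so \<open>comp_leI\<close> applies.\<close>

lemma ordered_partition_of_rank_selected_chain:
  assumes c: "composition n c" and C: "C \<in> order_complex (rank_selected n c) (\<subseteq>)"
  shows "\<exists>Cs\<in>ordered_partitions n. {} \<notin> set Cs \<and> comp_le c (op_type Cs) \<and> op_face Cs = C \<and>
    set (butlast Cs) = membership_blocks C \<and> last Cs = {1..n} - \<Union>C"
proof -
  have c': "c \<noteq> []" "sum_list c = n"
    using c by (auto simp: composition_def pointed_composition_def)
  then have zero: "0 \<in> partial_sums c"
    by (auto simp: partial_sums_def intro!: exI[of _ 0])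
  note n = partial_sums_less[OF c zero] c'
  have sel: "S \<subseteq> {1..n}" "S \<noteq> {}" "card S \<in> partial_sums c" if "S \<in> C" for S
    using C that by (auto simp: order_complex_def rank_selected_def)
  have "S \<noteq> {1..n}" if "S \<in> C" for S
    using partial_sums_less[OF c sel(3)[OF that]] by auto
  then obtain Cs where Cs: "Cs \<noteq> []" "{} \<notin> set Cs" "sorted_wrt disjnt Cs" "\<Union>(set Cs) = {1..n}"
      "op_face Cs = C" "set (butlast Cs) = membership_blocks C" "last Cs = {1..n} - \<Union>C"
    using ordered_partition_of_chain[of C "{1..n}"] C sel n(1)
    by (auto simp: order_complex_def psubset_eq)
  have "comp_le c (op_type Cs)"
  proof (rule comp_leI)
    have fin: "finite S" if "S \<in> set Cs" for S
      using that Cs(4) by (metis Union_upper finite_atLeastAtMost finite_subset)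
    show "0 < x" if "x \<in> set (op_type Cs)" for x
      using that Cs(2) fin by (auto simp: op_type_def card_gt_0_iff)
    show "partial_sums (op_type Cs) \<subseteq> partial_sums c"
      using partial_sums_op_type[OF Cs(1,3)] Cs(4,5) sel(3) zero by auto
    show "sum_list c = sum_list (op_type Cs)"
      using card_Union_sorted_wrt_disjnt[OF Cs(3) fin] Cs(4) n by (simp add: op_type_def)
  qed (use n Cs(1) composition_pos[OF c] in \<open>auto simp: op_type_def\<close>)
  moreover have "Cs \<in> ordered_partitions n"
    using Cs by (auto simp: ordered_partitions_def dest: in_set_butlastD)
  ultimately show ?thesis
    using Cs by blast
qed

text \<open>Merging entries only drops partial sums, so the initial unions of a face have selected
  sizes; conversely a chain of such sets comes from the ordered partition built above.\<close>

lemma op_complex_eq_order_complex: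
  assumes c: "composition n c"
  shows "op_complex n c = order_complex (rank_selected n c) (\<subseteq>)"
proof
  show "order_complex (rank_selected n c) (\<subseteq>) \<subseteq> op_complex n c"
    using ordered_partition_of_rank_selected_chain[OF c] unfolding op_complex_def by blast
  show "op_complex n c \<subseteq> order_complex (rank_selected n c) (\<subseteq>)"
  proof
    fix C assume "C \<in> op_complex n c"
    then obtain Cs where C: "C = op_face Cs" and Cs: "Cs \<noteq> []" "{} \<notin> set (butlast Cs)"
        "sorted_wrt disjnt Cs" "\<Union>(set Cs) = {1..n}" and le: "comp_le c (op_type Cs)"
      by (auto simp: op_complex_def ordered_partitions_def)
    have "finite (op_face Cs)"
      by (simp add: op_face_def)
    moreover have "Complete_Partial_Order.chain (\<subseteq>) (op_face Cs)"
    proof (rule chainI)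
      fix S T assume "S \<in> op_face Cs" "T \<in> op_face Cs"
      then obtain i j where "S = \<Union>(set (take i Cs))" "T = \<Union>(set (take j Cs))"
        by (auto simp: op_face_def)
      then show "S \<subseteq> T \<or> T \<subseteq> S"
        by (metis Union_mono nat_le_linear set_take_subset_set_take)
    qed
    moreover have "S \<in> rank_selected n c" if "S \<in> op_face Cs" for S
    proof -
      obtain i where i: "1 \<le> i" "i < length Cs" "S = \<Union>(set (take i Cs))"
        using \<open>S \<in> op_face Cs\<close> by (auto simp: op_face_def)
      have "set (take i Cs) \<subseteq> set Cs"
        by (rule set_take_subset)
      then have "S \<subseteq> {1..n}"
        using i(3) Cs(4) by blast
      \<comment> \<open>There are at least two blocks, so the first one is not the possibly empty
        last one.\<close>
      moreover have "Cs ! 0 \<in> set (butlast Cs)" "Cs ! 0 \<in> set (take i Cs)"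
        using i by (auto simp: in_set_conv_nth nth_butlast intro!: exI[of _ 0])
      then have "S \<noteq> {}"
        using Cs(2) i(3) by (metis Union_upper subset_empty)
      moreover have "card S \<in> partial_sums c"
        using comp_le_partial_sums[OF le] partial_sums_op_type[OF Cs(1,3)] Cs(4) that by auto
      ultimately show ?thesis
        by (simp add: rank_selected_def)
    qed
    ultimately show "C \<in> order_complex (rank_selected n c) (\<subseteq>)"
      by (auto simp: C order_complex_def)
  qed
qed

text \<open>Forgets the order of the blocks of the ordered partition given by \<open>C\<close>, its
  last block becoming the pointed one. The empty chain gives \<open>pp_top n\<close>.\<close>

definition chain_partition :: "nat \<Rightarrow> nat set set \<Rightarrow> pointed_partition" where
  "chain_partition n C = (membership_blocks C, {1..n} - \<Union>C)"

lemma chain_partition_mem: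
  assumes c: "composition n c" and C: "C \<in> order_complex (rank_selected n c) (\<subseteq>) - {{}}"
  shows "chain_partition n C \<in> pp_poset n c - {pp_top n}"
proof -
  obtain Cs where Cs: "Cs \<in> ordered_partitions n" "{} \<notin> set Cs" "comp_le c (op_type Cs)"
      "op_face Cs = C" "set (butlast Cs) = membership_blocks C" "last Cs = {1..n} - \<Union>C"
    using ordered_partition_of_rank_selected_chain[OF c] C by blast
  define Bs Z where "Bs = butlast Cs" and "Z = last Cs"
  have Cs_eq: "Cs = Bs @ [Z]"
    using Cs(1) by (auto simp: Bs_def Z_def ordered_partitions_def)
  have p: "chain_partition n C = (set Bs, Z)"
    using Cs by (simp add: chain_partition_def Bs_def Z_def)
  have sorted: "sorted_wrt disjnt Bs" "\<And>b. b \<in> set Bs \<Longrightarrow> disjnt b Z" "\<Union>(set Bs) \<union> Z = {1..n}"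
    using Cs(1) by (auto simp: Cs_eq ordered_partitions_def sorted_wrt_append)
  have ne: "{} \<notin> set Bs"
    using Cs(2) by (simp add: Cs_eq)
  \<comment> \<open>Distinctness is what identifies the multiset of sizes of \<open>set Bs\<close>
    with that of the list. It rests on the blocks being nonempty, since the empty set is disjoint
    from itself.\<close>
  have Bs: "distinct Bs \<and> disjoint (set Bs)"
    using sorted(1) ne
  proof (induction Bs)
    case (Cons b Bs)
    then have "disjnt b b'" if "b' \<in> set Bs" for b'
      using that by simp
    moreover have "b \<noteq> {}"
      using Cons.prems by auto
    ultimately have "b \<notin> set Bs"
      by (auto simp: disjnt_def)
    then show ?case
      using Cons by (auto simp: pairwise_insert disjnt_sym)
  qed simp
  have "\<Union>(set Bs) = {1..n} - Z"
    using sorted(2,3) by (auto simp: disjnt_def)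
  then have part: "(set Bs, Z) \<in> pointed_partitions n"
    using sorted(3) ne Bs by (auto simp: pointed_partitions_def partition_on_def)
  have "sum_list (op_type Cs) = n"
    using comp_le_sum_list[OF Cs(3)] c by (simp add: composition_def pointed_composition_def)
  moreover have "1 \<le> card b" if "b \<in> set Bs" for b
  proof -
    have "b \<subseteq> {1..n}"
      using that sorted(3) by blast
    then show ?thesis
      using that ne finite_subset[of b "{1..n}"] by (auto simp: Suc_le_eq card_gt_0_iff)
  qed
  ultimately have d: "pointed_composition n (op_type Cs)"
    by (auto simp: pointed_composition_def op_type_def Cs_eq)
  have "pp_type (set Bs, Z) = comp_type (op_type Cs)"
    using Bs by (simp add: pp_type_def comp_type_def op_type_def Cs_eq mset_set_set)
  then have "(set Bs, Z) \<in> pp_poset n c"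
    using part d Cs(3) by (auto simp: pp_poset_def)
  \<comment> \<open>A single block would give the empty face, so a nonempty chain leaves at least
    one non-pointed block.\<close>
  moreover have "Bs \<noteq> []"
    using C Cs(4) by (auto simp: Cs_eq op_face_def)
  then have "(set Bs, Z) \<noteq> pp_top n"
    by (simp add: pp_top_def)
  ultimately show ?thesis
    by (simp add: p)
qed

text \<open>The pointed block has size \<open>last d\<close>, so its complement has the size of the
  longest proper prefix sum of \<open>d\<close>, which is also a partial sum of
  \<open>c\<close>.\<close>

lemma complement_mem_rank_selected:
  assumes c: "composition n c" and p: "p \<in> pp_poset n c - {pp_top n}"
  shows "{1..n} - snd p \<in> rank_selected n c"
proof -
  obtain B Z where [simp]: "p = (B, Z)"
    by (cases p)
  obtain d where BZ: "Z \<subseteq> {1..n}" "partition_on ({1..n} - Z) B" and d: "pointed_composition n d"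
      "comp_le c d" "card Z = last d"
    using p by (auto simp: pp_poset_def pointed_partitions_def pp_type_def comp_type_def)
  have "{1..n} - Z \<noteq> {}"
  proof
    assume "{1..n} - Z = {}"
    then have "Z = {1..n}" "B = {}"
      using BZ by (auto simp: partition_on_def)
    then show False
      using p by (simp add: pp_top_def)
  qed
  have "d \<noteq> []" "sum_list d = n"
    using d(1) by (auto simp: pointed_composition_def)
  then have "sum_list (butlast d) + last d = n"
    by (metis append_butlast_last_id sum_list_append sum_list.Cons sum_list.Nil add.right_neutral)
  moreover have "card ({1..n} - Z) = n - card Z"
    using BZ(1) by (simp add: card_Diff_subset finite_subset)
  ultimately have "card ({1..n} - Z) = sum_list (take (length d - 1) d)"
    using d(3) by (simp add: butlast_conv_take)
  then have "card ({1..n} - Z) \<in> partial_sums d"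
    using \<open>d \<noteq> []\<close> by (auto simp: partial_sums_def)
  then show ?thesis
    using comp_le_partial_sums[OF d(2)] \<open>{1..n} - Z \<noteq> {}\<close> by (auto simp: rank_selected_def)
qed

text \<open>More sets separate more points, so a class for \<open>D\<close> meeting
  \<open>\<Union>C\<close> lies in a class for \<open>C\<close>. Any other class avoids
  \<open>\<Union>C\<close> and is absorbed by the pointed block.\<close>

lemma chain_partition_antimono:
  assumes "C \<subseteq> D" "\<Union>D \<subseteq> {1..n}"
  shows "pp_le (chain_partition n D) (chain_partition n C)"
proof -
  let ?cls = "\<lambda>C x. {y \<in> \<Union>C. \<forall>S\<in>C. x \<in> S \<longleftrightarrow> y \<in> S}"
  have "\<exists>b\<in>insert ({1..n} - \<Union>C) (membership_blocks C). ?cls D x \<subseteq> b" if x: "x \<in> \<Union>D" for x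
  proof (cases "x \<in> \<Union>C")
    case True
    then have "?cls D x \<subseteq> ?cls C x"
      using assms(1) by blast
    then show ?thesis
      using True by (auto simp: membership_blocks_def)
  next
    case False
    have "?cls D x \<subseteq> {1..n} - \<Union>C"
    proof (intro subsetI DiffI notI)
      fix y assume y: "y \<in> ?cls D x"
      then show "y \<in> {1..n}"
        using assms(2) by blast
      assume "y \<in> \<Union>C"
      then obtain S where "S \<in> C" "y \<in> S" by blast
      then have "x \<in> S"
        using y assms(1) by blast
      then show False
        using False \<open>S \<in> C\<close> by blast
    qed
    then show ?thesis
      by (rule bexI[OF _ insertI1])
  qed
  then have "\<forall>b\<in>membership_blocks D. \<exists>b'\<in>insert ({1..n} - \<Union>C) (membership_blocks C). b \<subseteq> b'"
    unfolding membership_blocks_def[of D] by (intro ballI) (elim imageE, simp only:)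
  moreover have "{1..n} - \<Union>D \<subseteq> {1..n} - \<Union>C"
    using assms(1) by blast
  ultimately show ?thesis
    by (simp only: pp_le_def chain_partition_def fst_conv snd_conv simp_thms)
qed

text \<open>As \<open>p\<close> is below every \<open>q\<close> in \<open>F\<close>, a block of
  \<open>p\<close> lies inside the pointed block of \<open>q\<close> or misses it. So no complement
  separates two points of the block. The complement of \<open>snd p\<close> is the largest one,
  hence the pointed blocks agree.\<close>

lemma le_chain_partition_complements:
  assumes F: "F \<subseteq> pointed_partitions n" and p: "p \<in> F" and le: "\<And>q. q \<in> F \<Longrightarrow> pp_le p q"
  shows "pp_le p (chain_partition n ((\<lambda>q. {1..n} - snd q) ` F))"
proof -
  let ?C = "(\<lambda>q. {1..n} - snd q) ` F"
  have part: "snd q \<subseteq> {1..n}" "partition_on ({1..n} - snd q) (fst q)" if "q \<in> F" for q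
    using subsetD[OF F that] by (simp_all add: pointed_partitions_def split_beta)
  have U: "\<Union>?C = {1..n} - snd p"
  proof
    have "snd p \<subseteq> snd q" if "q \<in> F" for q
      using le[OF that] by (simp add: pp_le_def)
    then show "\<Union>?C \<subseteq> {1..n} - snd p"
      by blast
  qed (use p in blast)
  have block: "b \<subseteq> snd q \<or> b \<inter> snd q = {}" if b: "b \<in> fst p" and q: "q \<in> F" for b q
  proof -
    obtain b' where "b' \<in> insert (snd q) (fst q)" "b \<subseteq> b'"
      using le[OF q] b unfolding pp_le_def by metis
    then show ?thesis
      using partition_onD1[OF part(2)[OF q]] by blast
  qed
  have "\<exists>b'\<in>membership_blocks ?C. b \<subseteq> b'" if b: "b \<in> fst p" for b
  proof -
    have bU: "b \<subseteq> {1..n} - snd p" "b \<noteq> {}"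
      using b partition_onD1[OF part(2)[OF p]] partition_onD3[OF part(2)[OF p]] by auto
    then obtain x where x: "x \<in> b" by blast
    have "b \<subseteq> {y \<in> \<Union>?C. \<forall>S\<in>?C. x \<in> S \<longleftrightarrow> y \<in> S}"
    proof
      fix y assume y: "y \<in> b"
      have "x \<in> snd q \<longleftrightarrow> y \<in> snd q" if "q \<in> F" for q
        using block[OF b that] x y by blast
      moreover have "x \<in> {1..n}" "y \<in> {1..n}" "y \<in> \<Union>?C"
        using bU x y U by auto
      ultimately show "y \<in> {y \<in> \<Union>?C. \<forall>S\<in>?C. x \<in> S \<longleftrightarrow> y \<in> S}"
        by simp
    qed
    moreover have "x \<in> \<Union>?C"
      using U bU x by blast
    ultimately show ?thesis
      unfolding membership_blocks_def by blast
  qed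
  moreover have "snd p \<subseteq> {1..n} - \<Union>?C"
    unfolding U using part(1)[OF p] by blast
  ultimately show ?thesis
    by (auto simp: pp_le_def chain_partition_def)
qed

lemma finite_pp_poset: "finite (pp_poset n c)"
proof (rule finite_subset)
  show "pp_poset n c \<subseteq> Pow (Pow {1..n}) \<times> Pow {1..n}"
    by (auto simp: pp_poset_def pointed_partitions_def partition_on_def)
qed simp

theorem theorem5p3:
  fixes n :: nat and c :: "nat list"
  assumes "composition n c"
  shows "geometric_realization (order_complex (pp_poset n c - {pp_top n}) pp_le)
           homotopy_equivalent_space
             geometric_realization (barycentric_subdivision (op_complex n c))
       \<and> geometric_realization (order_complex (pp_poset n c - {pp_top n}) pp_le)
           homotopy_equivalent_space
             geometric_realization (op_complex n c)"
proof -
  let ?P = "pp_poset n c - {pp_top n}"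
  define K where "K = order_complex (rank_selected n c) (\<subseteq>)"
  have opK: "op_complex n c = K"
    unfolding K_def by (rule op_complex_eq_order_complex[OF assms])
  have K: "finite_complex K"
    unfolding K_def by (rule finite_complex_order_complex[OF finite_rank_selected])
  have chains: "finite C" "Complete_Partial_Order.chain (\<subseteq>) C" "\<Union>C \<subseteq> {1..n}" if "C \<in> K" for C
    using that by (auto simp: K_def order_complex_def rank_selected_def)
  have eq: "geometric_realization (barycentric_subdivision K) homotopy_equivalent_space
      geometric_realization (order_complex ?P pp_le)"
  proof (rule barycentric_subdivision_homotopy_equivalent_order_complex
      [where f = "chain_partition n" and g = "\<lambda>p. {1..n} - snd p", OF K])
    show "finite ?P"
      using finite_pp_poset by simp
    show "(\<lambda>p. {1..n} - snd p) ` F \<in> K" if F: "F \<in> order_complex ?P pp_le" for F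
    proof -
      have "Complete_Partial_Order.chain (\<subseteq>) ((\<lambda>p. {1..n} - snd p) ` F)"
      proof (rule chainI)
        fix S T assume "S \<in> (\<lambda>p. {1..n} - snd p) ` F" "T \<in> (\<lambda>p. {1..n} - snd p) ` F"
        then obtain p q where pq: "p \<in> F" "q \<in> F" "S = {1..n} - snd p" "T = {1..n} - snd q"
          by blast
        have "pp_le p q \<or> pp_le q p"
          using F pq(1,2) by (auto simp: order_complex_def Complete_Partial_Order.chain_def)
        then show "S \<subseteq> T \<or> T \<subseteq> S"
          unfolding pq(3,4) pp_le_def by blast
      qed
      then show ?thesis
        using F complement_mem_rank_selected[OF assms] by (auto simp: K_def order_complex_def)
    qed
    show "chain_partition n C \<in> ?P" if "C \<in> K - {{}}" for C
      using chain_partition_mem[OF assms] that unfolding K_def .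
    show "pp_le (chain_partition n D) (chain_partition n C)"
      if "C \<in> K - {{}}" "D \<in> K - {{}}" "C \<subseteq> D" for C D
      using that chains(3) by (intro chain_partition_antimono) auto
    show "{1..n} - snd (chain_partition n C) \<in> C" if "C \<in> K - {{}}" for C
    proof -
      \<comment> \<open>The complement of the pointed block is the union of the chain, which is its
        largest member.\<close>
      have "{1..n} - snd (chain_partition n C) = \<Union>C"
        using chains(3) that by (auto simp: chain_partition_def)
      then show ?thesis
        using chain_subset_Union_mem[of C] chains that by auto
    qed
    show "pp_le p (chain_partition n ((\<lambda>p. {1..n} - snd p) ` F))"
      if "F \<in> order_complex ?P pp_le" "p \<in> F" "\<And>q. q \<in> F \<Longrightarrow> pp_le p q" for F p
      using that by (intro le_chain_partition_complements) (auto simp: order_complex_def pp_poset_def)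
  qed (rule pp_le_trans)
  then show ?thesis
    unfolding opK using barycentric_subdivision_homotopy_equivalent[OF K]
    by (meson homotopy_equivalent_space_sym homotopy_eqv_trans)
qed

end
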